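(* Let $\{\pi_n\}_{n\ge 0}$ be the monic Hermite polynomials, i.e. $\pi_0(x)=1$, $\pi_1(x)=x$ and $\pi_{n+1}(x)=x\pi_n(x)-\frac n2\pi_{n-1}(x)$ for $n\ge 1$. Let $\delta\in(0,1)$ be any fixed small number. For $y$ in a small complex neighborhood of $[-1+\delta,1-\delta]$, we have $$\pi_n(\sqrt{2n}\,y)\sim\left(\frac{n}{2e}\right)^{n/2}\frac{e^{ny^2}}{(1-y^2)^{1/4}}\left\{\cos\left[n(\theta-\sin\theta\cos\theta)+\frac{\theta}{2}\right]+\sin\left[n(\theta-\sin\theta\cos\theta)+\frac{\theta}{2}\right]\right\}$$ as $n\to\infty$, where $\theta=\theta(y):=\arccos y$. Precisely: writing $\Phi_n(y)=n(\theta-\sin\theta\cos\theta)+\frac{\theta}{2}$, there are an open set $U\subset\mathbb{C}$ containing $[-1+\delta,1-\delta]$ and functions $\varepsilon_n^{(1)},\varepsilon_n^{(2)}:U\to\mathbb{C}$ tending to $0$ uniformly on $U$ as $n\to\infty$ such that, for all $y\in U$ and all $n\ge 1$, $$\pi_n(\sqrt{2n}\,y)=\left(\frac{n}{2e}\right)^{n/2}\frac{e^{ny^2}}{(1-y^2)^{1/4}}\left\{\left(1+\varepsilon_n^{(1)}(y)\right)\cos\Phi_n(y)+\left(1+\varepsilon_n^{(2)}(y)\right)\sin\Phi_n(y)\right\}.$$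
   Context: The polynomials satisfy $\pi_n(x)=2^{-n}H_n(x)$, where $H_n$ is the (physicists') Hermite polynomial. On a small neighborhood of $[-1+\delta,1-\delta]$, $\theta=\arccos y$ is the analytic branch that is real with values in $(0,\pi)$ for real $y$ (so $0<\mathrm{Re}\,\theta<\pi$ and $y=\cos\theta$), and $(1-y^2)^{1/4}$ is the principal branch, positive for real $y\in(-1,1)$. *)

theory Defs
  imports "HOL-Analysis.Analysis" "HOL-Computational_Algebra.Polynomial"
begin

fun monic_hermite :: "nat \<Rightarrow> complex poly" where
  "monic_hermite 0 = 1"
| "monic_hermite (Suc 0) = [:0, 1:]"
| "monic_hermite (Suc (Suc n)) =
     [:0, 1:] * monic_hermite (Suc n) - smult (of_nat (Suc n) / 2) (monic_hermite n)"

text \<open>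
  The strip contains every small neighborhood of a compact subinterval of \<open>(-1, 1)\<close>. On it the
  principal values \<^const>\<open>Arccos\<close> and \<open>(1 - y\<^sup>2) powr (1/4)\<close> are the analytic branches that
  are real for real \<open>y\<close>, with \<open>0 < Re \<theta> < \<pi>\<close> for \<open>\<theta> = arccos y\<close>; see the lemmas below.
\<close>

definition unit_strip :: "complex set" where
  "unit_strip = {y. \<bar>Re y\<bar> < 1}"

definition hermite_phase :: "nat \<Rightarrow> complex \<Rightarrow> complex" where
  "hermite_phase n y =
     (let \<theta> = Arccos y in of_nat n * (\<theta> - sin \<theta> * cos \<theta>) + \<theta> / 2)"

lemma Arccos_branch:
  shows "Arccos holomorphic_on unit_strip"
    and "y \<in> unit_strip \<Longrightarrow> cos (Arccos y) = y"
    and "y \<in> unit_strip \<Longrightarrow> 0 < Re (Arccos y) \<and> Re (Arccos y) < pi"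
    and "-1 < x \<Longrightarrow> x < 1 \<Longrightarrow> Arccos (complex_of_real x) = complex_of_real (arccos x)"
  using Arccos_bounds[of y]
  by (auto simp: unit_strip_def of_real_arccos intro: holomorphic_on_Arccos)

lemma one_minus_square_not_nonpos:
  assumes "y \<in> unit_strip"
  shows "1 - y\<^sup>2 \<notin> \<real>\<^sub>\<le>\<^sub>0"
proof
  assume "1 - y\<^sup>2 \<in> \<real>\<^sub>\<le>\<^sub>0"
  then have re: "1 + (Im y)\<^sup>2 \<le> (Re y)\<^sup>2" and im: "Re y = 0 \<or> Im y = 0"
    by (auto simp: complex_nonpos_Reals_iff power2_eq_square)
  have "0 \<le> (Im y)\<^sup>2" by simp
  with re im have "Im y = 0" by (smt (verit) power_zero_numeral)
  moreover from this re have "1 \<le> \<bar>Re y\<bar>"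
    using abs_le_square_iff[of 1 "Re y"] by simp
  ultimately show False
    using assms by (simp add: unit_strip_def)
qed

lemma fourth_root_branch:
  shows "(\<lambda>y. (1 - y\<^sup>2) powr (1 / 4)) holomorphic_on unit_strip"
    and "-1 < x \<Longrightarrow> x < 1 \<Longrightarrow>
      (1 - (complex_of_real x)\<^sup>2) powr (1 / 4) = complex_of_real ((1 - x\<^sup>2) powr (1 / 4))"
proof -
  show "(\<lambda>y. (1 - y\<^sup>2) powr (1 / 4)) holomorphic_on unit_strip"
    using one_minus_square_not_nonpos by (intro holomorphic_intros) auto
next
  assume "-1 < x" "x < 1"
  then have "0 \<le> 1 - x\<^sup>2"
    using abs_square_le_1[of x] by auto
  then show "(1 - (complex_of_real x)\<^sup>2) powr (1 / 4) = complex_of_real ((1 - x\<^sup>2) powr (1 / 4))"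
    by (simp add: powr_of_real[symmetric])
qed

end

theory Submission
  imports Defs "HOL-Real_Asymp.Real_Asymp"
begin

text \<open>
  The proof is a Liouville--Green (WKB) analysis with explicit error control. Put
  \<open>S = sin \<theta>\<close> with \<open>\<theta> = arccos y\<close>, let \<open>\<Phi>\<close> be the phase \<^const>\<open>hermite_phase\<close>, and let
  \<open>X\<close> be the polynomial \<open>\<pi>\<^sub>n(\<surd>(2n) y)\<close> divided by the claimed prefactor, so that the claim
  reads \<open>X = cos \<Phi> + sin \<Phi>\<close> up to a small error. Hermite's differential equation turns into a
  second order equation for \<open>X\<close>. The point is that \<open>\<Phi>' = - (4nS\<^sup>2 + 1) / (2S)\<close> is such a
  good approximation of its frequency that, with \<open>Y = X' / (\<i>\<Phi>')\<close>, the two waves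
  \<open>u = (X + Y) / 2\<close> and \<open>v = (X - Y) / 2\<close> satisfy
  \<open>u' = \<i>\<Phi>' u + r\<close> and \<open>v' = -\<i>\<Phi>' v - r\<close>, where the coupling \<open>r\<close> is only
  \<open>O(1/n)\<close> times \<open>\<bar>u\<bar> + \<bar>v\<bar>\<close> (\<open>hermite_wave_derivative\<close>,
  \<open>hermite_cowave_derivative\<close>, \<open>wave_coupling_bound\<close>).

  For complex \<open>y\<close> one of \<open>exp(\<plusminus>\<i>\<Phi>)\<close> is exponentially larger than the other, and errors in
  the dominant wave cannot be controlled relative to the recessive one. Relative to
  \<open>exp \<bar>Im \<Phi>\<bar>\<close>, however, they are controlled along any path on which \<open>\<bar>Im \<Phi>\<bar>\<close> never
  decreases (\<open>coupled_propagation\<close>). The path from \<open>0\<close> to \<open>Re y\<close> and then vertically to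
  \<open>y\<close> has this property: \<open>Im \<Phi>\<close> vanishes on the real leg, and on the vertical leg it is monotone
  since \<open>Re S > 0\<close>, hence \<open>Re \<Phi>' < 0\<close>, in the whole strip. So \<open>u\<close> and \<open>v\<close> are
  \<open>exp(\<i>\<Phi>)\<close> and \<open>exp(-\<i>\<Phi>)\<close> times their normalized values at the origin, up to
  \<open>O(1/n) exp \<bar>Im \<Phi>\<bar>\<close> (\<open>wave_estimate\<close>).

  The values at the origin are quotients of factorials. Their limit follows from the mere existence
  of the limit \<open>K\<close> of \<open>n! e\<^sup>n / n\<^sup>n\<^sup>+\<^sup>1\<^sup>/\<^sup>2\<close>, because \<open>K\<close> cancels in \<open>(2m)! / (m! 4\<^sup>m)\<close>
  (\<open>hermite_central_asymptotic\<close>, \<open>central_amplitude_limit\<close>).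

  An error that is small compared to \<open>exp \<bar>Im \<Phi>\<bar>\<close> is what the two correction factors can absorb:
  \<open>cos \<Phi>\<close> and \<open>sin \<Phi>\<close> are never small simultaneously, since
  \<open>\<bar>cos \<Phi>\<bar>\<^sup>2 + \<bar>sin \<Phi>\<bar>\<^sup>2 = cosh (2 Im \<Phi>)\<close> (\<open>trig_error_splitting\<close>).
\<close>

section \<open>Values of the Hermite polynomials at the origin\<close>

lemma tendsto_even_odd:
  fixes f :: "nat \<Rightarrow> 'a::real_normed_vector"
  assumes "(\<lambda>m. f (2 * m)) \<longlonglongrightarrow> L" and "(\<lambda>m. f (2 * m + 1)) \<longlonglongrightarrow> L"
  shows "f \<longlonglongrightarrow> L"
proof (rule LIMSEQ_I)
  fix r :: real assume "0 < r"
  obtain M where M: "\<And>m. m \<ge> M \<Longrightarrow> norm (f (2 * m) - L) < r"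
    using LIMSEQ_D[OF assms(1) \<open>0 < r\<close>] by blast
  obtain N where N: "\<And>m. m \<ge> N \<Longrightarrow> norm (f (2 * m + 1) - L) < r"
    using LIMSEQ_D[OF assms(2) \<open>0 < r\<close>] by blast
  have "norm (f n - L) < r" if "n \<ge> 2 * (M + N) + 1" for n
  proof (cases "even n")
    case True
    then obtain m where "n = 2 * m" by (elim evenE)
    with that M[of m] show ?thesis by simp
  next
    case False
    then obtain m where "n = 2 * m + 1" by (elim oddE)
    with that N[of m] show ?thesis by simp
  qed
  then show "\<exists>k. \<forall>n\<ge>k. norm (f n - L) < r" by blast
qed

text \<open>
  The weak form of Stirling's formula: the constant is left unidentified, as it will cancel. The
  logarithms of the quotients have increments of size \<open>O(1/n\<^sup>2)\<close>, hence converge.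
\<close>

lemma fact_asymptotic:
  obtains K :: real where "K > 0"
    and "(\<lambda>n. fact n / (sqrt (real n) * (real n / exp 1) powr real n)) \<longlonglongrightarrow> K"
proof -
  define x where "x n = ln (fact (Suc n)) - (real (Suc n) + 1/2) * ln (real (Suc n)) + real (Suc n)" for n
  have step: "x (Suc n) - x n = 1 - (real (Suc n) + 1/2) * (ln (real (Suc (Suc n))) - ln (real (Suc n)))" for n
  proof -
    have "ln (fact (Suc (Suc n)) :: real) = ln (real (Suc (Suc n))) + ln (fact (Suc n))"
      by (subst fact_Suc) (subst ln_mult, auto)
    then show ?thesis by (simp add: x_def algebra_simps)
  qed
  have "summable (\<lambda>n. x (Suc n) - x n)"
  proof (rule summable_comparison_test_bigo)
    show "(\<lambda>n. x (Suc n) - x n) \<in> O(\<lambda>n. inverse (real (Suc n) ^ 2))"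
      unfolding step by real_asymp
    show "summable (\<lambda>n. norm (inverse (real (Suc n) ^ 2)))"
      using inverse_power_summable[of 2, where ?'a = real]
      by (subst summable_Suc_iff) simp
  qed
  then have "(\<lambda>N. \<Sum>n<N. x (Suc n) - x n) \<longlonglongrightarrow> (\<Sum>n. x (Suc n) - x n)"
    by (rule summable_LIMSEQ)
  then have "(\<lambda>N. (x N - x 0) + x 0) \<longlonglongrightarrow> (\<Sum>n. x (Suc n) - x n) + x 0"
    unfolding sum_lessThan_telescope by (intro tendsto_intros)
  then obtain l where "x \<longlonglongrightarrow> l" by (auto simp: )
  then have lim: "(\<lambda>n. exp (x n)) \<longlonglongrightarrow> exp l" by (intro tendsto_intros)
  have "exp (x n) = fact (Suc n) / (sqrt (real (Suc n)) * (real (Suc n) / exp 1) powr real (Suc n))" for n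
  proof -
    have *: "x n = ln (fact (Suc n)) - (ln (real (Suc n)) / 2 + real (Suc n) * (ln (real (Suc n)) - 1))"
      by (simp add: x_def algebra_simps)
    have "exp (ln (real (Suc n)) / 2) = sqrt (real (Suc n))"
      by (simp flip: ln_sqrt)
    moreover have "exp (real (Suc n) * (ln (real (Suc n)) - 1)) = (real (Suc n) / exp 1) powr real (Suc n)"
      by (simp add: powr_def ln_div)
    ultimately show ?thesis
      unfolding * exp_diff exp_add by (simp del: fact_Suc of_nat_Suc)
  qed
  with lim have "(\<lambda>n. fact (Suc n) / (sqrt (real (Suc n)) * (real (Suc n) / exp 1) powr real (Suc n))) \<longlonglongrightarrow> exp l"
    by simp
  then have "(\<lambda>n. fact n / (sqrt (real n) * (real n / exp 1) powr real n)) \<longlonglongrightarrow> exp l"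
    by (rule LIMSEQ_imp_Suc)
  with that[of "exp l"] show ?thesis by simp
qed

text \<open>
  The absolute value of the Hermite polynomial of degree \<open>2m\<close> at the origin.
\<close>

definition hermite_central :: "nat \<Rightarrow> real" where
  "hermite_central m = fact (2 * m) / (fact m * 4 ^ m)"

text \<open>
  Writing \<open>b\<close> for the quotients of \<open>fact_asymptotic\<close>, the left side is \<open>\<surd>2 b(2m) / b(m)\<close>, and
  both values of \<open>b\<close> have the same nonzero limit.
\<close>

lemma hermite_central_asymptotic:
  "(\<lambda>m. hermite_central m / (real m / exp 1) powr real m) \<longlonglongrightarrow> sqrt 2"
proof -
  obtain K :: real where K: "K > 0" and
    lim: "(\<lambda>n. fact n / (sqrt (real n) * (real n / exp 1) powr real n)) \<longlonglongrightarrow> K" (is "?b \<longlonglongrightarrow> K")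
    by (rule fact_asymptotic)
  have "filterlim (\<lambda>m::nat. 2 * m) sequentially sequentially"
    by (intro filterlim_subseq) (auto simp: strict_mono_def)
  then have "(\<lambda>m. ?b (2 * m)) \<longlonglongrightarrow> K"
    using lim by (rule filterlim_compose[rotated])
  then have "(\<lambda>m. sqrt 2 * (?b (2 * m) / ?b m)) \<longlonglongrightarrow> sqrt 2 * (K / K)"
    using K lim by (intro tendsto_intros) auto
  moreover have "eventually (\<lambda>m. sqrt 2 * (?b (2 * m) / ?b m) =
      hermite_central m / (real m / exp 1) powr real m) sequentially"
    using eventually_gt_at_top[of 0]
  proof eventually_elim
    case (elim m)
    have "(real (2 * m) / exp 1) powr real (2 * m) =
        4 ^ m * ((real m / exp 1) powr real m * (real m / exp 1) powr real m)"
    proof -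
      have "(real (2 * m) / exp 1) powr real (2 * m) = (2 * (real m / exp 1)) powr real (2 * m)"
        by simp
      also have "\<dots> = 2 powr real (2 * m) * (real m / exp 1) powr real (2 * m)"
        by (subst powr_mult) auto
      also have "2 powr real (2 * m) = (4::real) ^ m"
        by (subst powr_realpow) (auto simp: power_mult)
      also have "(real m / exp 1) powr real (2 * m) =
          (real m / exp 1) powr real m * (real m / exp 1) powr real m"
        by (simp flip: powr_add)
      finally show ?thesis .
    qed
    with elim show ?case
      by (simp add: hermite_central_def real_sqrt_mult field_simps)
  qed
  ultimately show ?thesis
    using K by (simp add: filterlim_cong)
qed

lemma pderiv_monic_hermite:
  "pderiv (monic_hermite (Suc n)) = smult (of_nat (Suc n)) (monic_hermite n)"
proof (induction n rule: monic_hermite.induct)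
  case (3 n)
  have "pderiv (monic_hermite (Suc (Suc (Suc n)))) =
      monic_hermite (Suc (Suc n)) + [:0, 1:] * pderiv (monic_hermite (Suc (Suc n)))
      - smult (of_nat (Suc (Suc n)) / 2) (pderiv (monic_hermite (Suc n)))"
    unfolding monic_hermite.simps(3)[of "Suc n"]
    by (simp only: pderiv_diff pderiv_mult pderiv_smult) (simp add: pderiv_pCons)
  also have "\<dots> = monic_hermite (Suc (Suc n)) + smult (of_nat (Suc (Suc n)))
      ([:0, 1:] * monic_hermite (Suc n) - smult (of_nat (Suc n) / 2) (monic_hermite n))"
    unfolding 3 by (simp add: algebra_simps smult_diff_right)
  also have "\<dots> = smult (of_nat (Suc (Suc (Suc n)))) (monic_hermite (Suc (Suc n)))"
    unfolding monic_hermite.simps(3)[symmetric] of_nat_Suc[of "Suc (Suc n)"] smult_add_left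
    by (simp only: smult_1_left)
  finally show ?case .
qed (auto simp: pderiv_pCons pderiv_diff pderiv_mult pderiv_smult one_pCons)

lemma poly_monic_hermite_zero_even: "poly (monic_hermite (2 * m)) 0 = (-1) ^ m * of_real (hermite_central m)"
proof (induction m)
  case (Suc m)
  have eq: "hermite_central (Suc m) = (2 * m + 1) / 2 * hermite_central m"
  proof -
    have "fact (2 * Suc m) = 2 * (real m + 1) * (2 * real m + 1) * fact (2 * m)"
      by (simp add: algebra_simps)
    moreover have "fact (Suc m) = (real m + 1) * fact m"
      by simp
    ultimately show ?thesis
      by (simp add: hermite_central_def divide_simps del: fact_Suc) (simp add: algebra_simps)
  qed
  from Suc show ?case by (simp add: eq field_simps)
qed (auto simp: hermite_central_def)

lemma poly_monic_hermite_zero_odd: "poly (monic_hermite (2 * m + 1)) 0 = 0"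
  by (induction m) auto

section \<open>Propagation of coupled oscillations in the complex plane\<close>

text \<open>
  Removing the oscillation leaves \<open>W = exp(-\<i>\<phi>) u\<close> with \<open>W' = exp(-\<i>\<phi>) r\<close>, of norm at most
  \<open>B exp(\<bar>Im \<phi>\<bar> + Im \<phi>)\<close>. The last hypothesis says that
  \<open>Im \<phi>(s)\<close> lies between \<open>0\<close> and \<open>Im \<phi>(z)\<close>, so the exponent is largest at \<open>z\<close>. There
  the factor \<open>exp(\<i>\<phi>)\<close> that restores \<open>u\<close> cancels the \<open>Im \<phi>\<close>.
\<close>

lemma component_propagation:
  fixes u r \<phi> \<phi>' :: "complex \<Rightarrow> complex"
  assumes u: "\<And>s. s \<in> closed_segment p z \<Longrightarrow> (u has_field_derivative \<i> * \<phi>' s * u s + r s) (at s)"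
    and \<phi>: "\<And>s. s \<in> closed_segment p z \<Longrightarrow> (\<phi> has_field_derivative \<phi>' s) (at s)"
    and r: "\<And>s. s \<in> closed_segment p z \<Longrightarrow> norm (r s) \<le> B * exp \<bar>Im (\<phi> s)\<bar>"
    and mono: "\<And>s. s \<in> closed_segment p z \<Longrightarrow>
      \<bar>Im (\<phi> s)\<bar> + \<bar>Im (\<phi> z) - Im (\<phi> s)\<bar> \<le> \<bar>Im (\<phi> z)\<bar>"
  shows "norm (u z - exp (\<i> * \<phi> z) * (exp (-(\<i> * \<phi> p)) * u p)) \<le> B * norm (z - p) * exp \<bar>Im (\<phi> z)\<bar>"
proof -
  have "0 \<le> B * exp \<bar>Im (\<phi> p)\<bar>"
    using r[of p] norm_ge_zero order_trans ends_in_segment(1) by blast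
  then have B: "0 \<le> B" by (simp add: zero_le_mult_iff)
  define W where "W s = exp (-(\<i> * \<phi> s)) * u s" for s
  have "norm (W z - W p) \<le> (B * exp (\<bar>Im (\<phi> z)\<bar> + Im (\<phi> z))) * norm (z - p)"
  proof (rule field_differentiable_bound)
    fix s assume s: "s \<in> closed_segment p z"
    show "(W has_field_derivative exp (-(\<i> * \<phi> s)) * r s) (at s within closed_segment p z)"
      unfolding W_def
      by (rule derivative_eq_intros has_field_derivative_at_within[OF u[OF s]]
          has_field_derivative_at_within[OF \<phi>[OF s]] refl)+
        (simp add: algebra_simps)
    have "norm (exp (-(\<i> * \<phi> s)) * r s) \<le> exp (Im (\<phi> s)) * (B * exp \<bar>Im (\<phi> s)\<bar>)"
      using r[OF s] by (simp add: norm_mult)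
    also have "\<dots> = B * exp (\<bar>Im (\<phi> s)\<bar> + Im (\<phi> s))"
      by (simp add: exp_add)
    also have "\<dots> \<le> B * exp (\<bar>Im (\<phi> z)\<bar> + Im (\<phi> z))"
    proof -
      have "\<bar>Im (\<phi> s)\<bar> + Im (\<phi> s) \<le> \<bar>Im (\<phi> z)\<bar> + Im (\<phi> z)"
        using mono[OF s] by linarith
      then show ?thesis
        using B by (intro mult_left_mono) simp_all
    qed
    finally show "norm (exp (-(\<i> * \<phi> s)) * r s) \<le> B * exp (\<bar>Im (\<phi> z)\<bar> + Im (\<phi> z))" .
  qed auto
  moreover have "u z - exp (\<i> * \<phi> z) * (exp (-(\<i> * \<phi> p)) * u p) = exp (\<i> * \<phi> z) * (W z - W p)"
    by (simp add: W_def algebra_simps exp_minus)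
  then have "norm (u z - exp (\<i> * \<phi> z) * (exp (-(\<i> * \<phi> p)) * u p)) = exp (- Im (\<phi> z)) * norm (W z - W p)"
    by (simp only: norm_mult norm_exp_eq_Re) simp
  ultimately have "norm (u z - exp (\<i> * \<phi> z) * (exp (-(\<i> * \<phi> p)) * u p)) \<le>
      exp (- Im (\<phi> z)) * ((B * exp (\<bar>Im (\<phi> z)\<bar> + Im (\<phi> z))) * norm (z - p))"
    by (simp add: mult_left_mono)
  also have "\<dots> = B * norm (z - p) * exp \<bar>Im (\<phi> z)\<bar>"
    by (simp add: exp_add exp_minus field_simps)
  finally show ?thesis .
qed

text \<open>
  The largest value \<open>M\<close> of \<open>(\<bar>u\<bar> + \<bar>v\<bar>) exp(-\<bar>Im \<phi>\<bar>)\<close> on the segment bounds \<open>r\<close> by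
  \<open>\<kappa>M exp \<bar>Im \<phi>\<bar>\<close>, so \<open>component_propagation\<close> applies to \<open>u\<close> with \<open>\<phi>\<close> and to \<open>v\<close> with
  \<open>-\<phi>\<close>. At the point where it is attained, the resulting estimate bounds \<open>M\<close> by the initial
  values plus \<open>2\<kappa>M \<le> M/2\<close>, so no Gronwall argument is needed.
\<close>

lemma coupled_propagation:
  fixes u v r \<phi> \<phi>' :: "complex \<Rightarrow> complex"
  assumes u: "\<And>s. s \<in> closed_segment p q \<Longrightarrow> (u has_field_derivative \<i> * \<phi>' s * u s + r s) (at s)"
    and v: "\<And>s. s \<in> closed_segment p q \<Longrightarrow> (v has_field_derivative -(\<i> * \<phi>' s * v s) - r s) (at s)"
    and \<phi>: "\<And>s. s \<in> closed_segment p q \<Longrightarrow> (\<phi> has_field_derivative \<phi>' s) (at s)"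
    and r: "\<And>s. s \<in> closed_segment p q \<Longrightarrow> norm (r s) \<le> \<kappa> * (norm (u s) + norm (v s))"
    and mono: "\<And>s z. z \<in> closed_segment p q \<Longrightarrow> s \<in> closed_segment p z \<Longrightarrow>
      \<bar>Im (\<phi> s)\<bar> + \<bar>Im (\<phi> z) - Im (\<phi> s)\<bar> \<le> \<bar>Im (\<phi> z)\<bar>"
    and \<kappa>: "0 \<le> \<kappa>" "4 * \<kappa> \<le> 1" and len: "norm (q - p) \<le> 1"
  defines "u\<^sub>0 \<equiv> exp (-(\<i> * \<phi> p)) * u p" and "v\<^sub>0 \<equiv> exp (\<i> * \<phi> p) * v p"
  shows "norm (u q - exp (\<i> * \<phi> q) * u\<^sub>0) \<le> 2 * \<kappa> * (norm u\<^sub>0 + norm v\<^sub>0) * exp \<bar>Im (\<phi> q)\<bar>"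
    and "norm (v q - exp (-(\<i> * \<phi> q)) * v\<^sub>0) \<le> 2 * \<kappa> * (norm u\<^sub>0 + norm v\<^sub>0) * exp \<bar>Im (\<phi> q)\<bar>"
proof -
  define N where "N s = (norm (u s) + norm (v s)) * exp (- \<bar>Im (\<phi> s)\<bar>)" for s
  have cont: "continuous_on (closed_segment p q) u" "continuous_on (closed_segment p q) v"
      "continuous_on (closed_segment p q) \<phi>"
    by (auto intro!: continuous_at_imp_continuous_on intro: DERIV_isCont u v \<phi>)
  have "continuous_on (closed_segment p q) N"
    unfolding N_def by (intro continuous_intros cont)
  then obtain z where z: "z \<in> closed_segment p q" and max: "\<And>s. s \<in> closed_segment p q \<Longrightarrow> N s \<le> N z"
    using continuous_attains_sup[of "closed_segment p q" N] by auto
  have N0: "0 \<le> N z" by (simp add: N_def)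
  \<comment> \<open>\<open>N\<close> has removed the exponential growth; \<open>uvN\<close> puts it back.\<close>
  have uvN: "norm (u s) + norm (v s) = N s * exp \<bar>Im (\<phi> s)\<bar>" for s
    by (simp add: N_def exp_minus)
  have est: "norm (u x - exp (\<i> * \<phi> x) * u\<^sub>0) \<le> \<kappa> * N z * exp \<bar>Im (\<phi> x)\<bar> \<and>
      norm (v x - exp (-(\<i> * \<phi> x)) * v\<^sub>0) \<le> \<kappa> * N z * exp \<bar>Im (\<phi> x)\<bar>"
    if x: "x \<in> closed_segment p q" for x
  proof -
    have sub: "s \<in> closed_segment p q" if "s \<in> closed_segment p x" for s
      using that x by (meson ends_in_segment(1) subsetD subset_closed_segment)
    have r': "norm (r s) \<le> \<kappa> * N z * exp \<bar>Im (\<phi> s)\<bar>" if s: "s \<in> closed_segment p x" for s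
    proof -
      have "norm (r s) \<le> \<kappa> * (N s * exp \<bar>Im (\<phi> s)\<bar>)"
        using r[OF sub[OF s]] by (simp add: uvN)
      also have "\<dots> \<le> \<kappa> * (N z * exp \<bar>Im (\<phi> s)\<bar>)"
        by (intro mult_left_mono mult_right_mono max[OF sub[OF s]] \<kappa>(1) exp_ge_zero)
      finally show ?thesis by (simp add: mult.assoc)
    qed
    have "norm (x - p) \<le> 1"
      using segment_bound(1)[OF x] len by linarith
    then have len': "\<kappa> * N z * norm (x - p) * exp \<bar>Im (\<phi> x)\<bar> \<le> \<kappa> * N z * exp \<bar>Im (\<phi> x)\<bar>"
      by (intro mult_right_mono mult_left_le mult_nonneg_nonneg \<kappa>(1) N0 exp_ge_zero)
    have "norm (u x - exp (\<i> * \<phi> x) * u\<^sub>0) \<le> \<kappa> * N z * norm (x - p) * exp \<bar>Im (\<phi> x)\<bar>"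
      unfolding u\<^sub>0_def
      by (rule component_propagation[where r = r and \<phi>' = \<phi>', OF u[OF sub] \<phi>[OF sub] r' mono[OF x]])
    moreover have "norm (v x - exp (\<i> * - \<phi> x) * (exp (- (\<i> * - \<phi> p)) * v p))
        \<le> \<kappa> * N z * norm (x - p) * exp \<bar>Im (- \<phi> x)\<bar>"
    proof (rule component_propagation[where r = "\<lambda>s. - r s" and \<phi>' = "\<lambda>s. - \<phi>' s"])
      fix s assume s: "s \<in> closed_segment p x"
      show "(v has_field_derivative \<i> * - \<phi>' s * v s + - r s) (at s)"
        using v[OF sub[OF s]] by simp
      show "((\<lambda>x. - \<phi> x) has_field_derivative - \<phi>' s) (at s)"
        using \<phi>[OF sub[OF s]] by (rule DERIV_minus)
      show "norm (- r s) \<le> \<kappa> * N z * exp \<bar>Im (- \<phi> s)\<bar>"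
        using r'[OF s] by simp
      show "\<bar>Im (- \<phi> s)\<bar> + \<bar>Im (- \<phi> x) - Im (- \<phi> s)\<bar> \<le> \<bar>Im (- \<phi> x)\<bar>"
        using mono[OF x s] by simp
    qed
    ultimately show ?thesis
      using len' by (simp add: v\<^sub>0_def)
  qed
  have "N z * exp \<bar>Im (\<phi> z)\<bar> \<le> (norm u\<^sub>0 + norm v\<^sub>0 + 2 * \<kappa> * N z) * exp \<bar>Im (\<phi> z)\<bar>"
  proof -
    have "norm (exp (\<i> * \<phi> z) * u\<^sub>0) \<le> exp \<bar>Im (\<phi> z)\<bar> * norm u\<^sub>0"
      by (simp add: norm_mult mult_right_mono)
    moreover have "norm (exp (-(\<i> * \<phi> z)) * v\<^sub>0) \<le> exp \<bar>Im (\<phi> z)\<bar> * norm v\<^sub>0"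
      by (simp add: norm_mult mult_right_mono)
    moreover have "norm (u z) \<le> norm (u z - exp (\<i> * \<phi> z) * u\<^sub>0) + norm (exp (\<i> * \<phi> z) * u\<^sub>0)"
      using norm_triangle_ineq[of "u z - exp (\<i> * \<phi> z) * u\<^sub>0" "exp (\<i> * \<phi> z) * u\<^sub>0"] by simp
    moreover have "norm (v z) \<le> norm (v z - exp (-(\<i> * \<phi> z)) * v\<^sub>0) + norm (exp (-(\<i> * \<phi> z)) * v\<^sub>0)"
      using norm_triangle_ineq[of "v z - exp (-(\<i> * \<phi> z)) * v\<^sub>0" "exp (-(\<i> * \<phi> z)) * v\<^sub>0"] by simp
    ultimately have "norm (u z) + norm (v z) \<le>
        (\<kappa> * N z * exp \<bar>Im (\<phi> z)\<bar> + exp \<bar>Im (\<phi> z)\<bar> * norm u\<^sub>0) +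
        (\<kappa> * N z * exp \<bar>Im (\<phi> z)\<bar> + exp \<bar>Im (\<phi> z)\<bar> * norm v\<^sub>0)"
      using conjunct1[OF est[OF z]] conjunct2[OF est[OF z]] by linarith
    also have "\<dots> = (norm u\<^sub>0 + norm v\<^sub>0 + 2 * \<kappa> * N z) * exp \<bar>Im (\<phi> z)\<bar>"
      by (simp only: ring_distribs mult_ac add_ac mult_2)
    finally show ?thesis
      by (simp only: uvN)
  qed
  then have "N z \<le> norm u\<^sub>0 + norm v\<^sub>0 + 2 * (\<kappa> * N z)"
    by (simp add: mult.assoc)
  moreover have "4 * (\<kappa> * N z) \<le> N z"
    using mult_right_mono[OF \<kappa>(2) N0] by (simp add: mult.assoc)
  ultimately have "N z \<le> 2 * (norm u\<^sub>0 + norm v\<^sub>0)"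
    by argo
  then have "\<kappa> * N z * exp \<bar>Im (\<phi> q)\<bar> \<le> \<kappa> * (2 * (norm u\<^sub>0 + norm v\<^sub>0)) * exp \<bar>Im (\<phi> q)\<bar>"
    by (intro mult_right_mono mult_left_mono \<kappa>(1) exp_ge_zero)
  also have "\<dots> = 2 * \<kappa> * (norm u\<^sub>0 + norm v\<^sub>0) * exp \<bar>Im (\<phi> q)\<bar>"
    by (simp only: mult_ac)
  finally have *: "\<kappa> * N z * exp \<bar>Im (\<phi> q)\<bar> \<le> \<dots>" .
  show "norm (u q - exp (\<i> * \<phi> q) * u\<^sub>0) \<le> 2 * \<kappa> * (norm u\<^sub>0 + norm v\<^sub>0) * exp \<bar>Im (\<phi> q)\<bar>"
    using est[OF ends_in_segment(2)] * by (blast intro: order_trans)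
  show "norm (v q - exp (-(\<i> * \<phi> q)) * v\<^sub>0) \<le> 2 * \<kappa> * (norm u\<^sub>0 + norm v\<^sub>0) * exp \<bar>Im (\<phi> q)\<bar>"
    using est[OF ends_in_segment(2)] * by (blast intro: order_trans)
qed

section \<open>The phase and its monotonicity\<close>

text \<open>
  On the strip this is the branch of \<open>\<surd>(1 - y\<^sup>2)\<close> with positive real part.
\<close>

definition sine_branch :: "complex \<Rightarrow> complex" where
  "sine_branch y = sin (Arccos y)"

lemma sine_branch_square: "(sine_branch y)\<^sup>2 = 1 - y\<^sup>2"
  by (simp add: sine_branch_def sin_squared_eq)

lemma Re_sine_branch_pos: "y \<in> unit_strip \<Longrightarrow> 0 < Re (sine_branch y)"
  using Arccos_branch(3)[of y]
  by (auto simp: sine_branch_def Re_sin intro!: mult_pos_pos add_pos_pos sin_gt_zero)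

lemma sine_branch_nonzero: "y \<in> unit_strip \<Longrightarrow> sine_branch y \<noteq> 0"
  using Re_sine_branch_pos[of y] by auto

lemma Arccos_derivative:
  "y \<in> unit_strip \<Longrightarrow> (Arccos has_field_derivative - 1 / sine_branch y) (at y)"
  using has_field_derivative_Arccos[of y]
  by (simp add: unit_strip_def sine_branch_def divide_inverse)

lemma sine_branch_derivative:
  assumes "y \<in> unit_strip"
  shows "(sine_branch has_field_derivative - y / sine_branch y) (at y)"
proof -
  have "((\<lambda>y. sin (Arccos y)) has_field_derivative - y / sine_branch y) (at y)"
    by (rule derivative_eq_intros Arccos_derivative[OF assms] refl)+ simp
  then show ?thesis by (simp add: sine_branch_def[abs_def])
qed

text \<open>
  The derivative of the phase, see \<open>hermite_phase_derivative\<close>. It is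
  \<open>-(2nS + 1/(2S))\<close>, the two leading terms of \<open>-\<surd>(4n\<^sup>2S\<^sup>2 + 2n)\<close> for large \<open>n\<close>.
\<close>

definition phase_slope :: "nat \<Rightarrow> complex \<Rightarrow> complex" where
  "phase_slope n y = - (4 * of_nat n * (sine_branch y)\<^sup>2 + 1) / (2 * sine_branch y)"

lemma hermite_phase_derivative:
  assumes y: "y \<in> unit_strip"
  shows "(hermite_phase n has_field_derivative phase_slope n y) (at y)"
proof -
  let ?S = "sine_branch y"
  have "((\<lambda>y. of_nat n * (Arccos y - sin (Arccos y) * cos (Arccos y)) + Arccos y / 2)
      has_field_derivative of_nat n * (- 1 / ?S - (cos (Arccos y) * (- 1 / ?S) * cos (Arccos y)
        + - sin (Arccos y) * (- 1 / ?S) * sin (Arccos y))) + - 1 / (2 * ?S)) (at y)"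
    by (rule derivative_eq_intros Arccos_derivative[OF y] refl)+ simp_all
  also have "of_nat n * (- 1 / ?S - (cos (Arccos y) * (- 1 / ?S) * cos (Arccos y)
        + - sin (Arccos y) * (- 1 / ?S) * sin (Arccos y))) + - 1 / (2 * ?S)
      = - (2 * of_nat n * (1 - y\<^sup>2 + ?S\<^sup>2) + 1) / (2 * ?S)"
    using sine_branch_nonzero[OF y]
    by (simp add: field_simps power2_eq_square flip: sine_branch_def)
  also have "\<dots> = phase_slope n y"
    by (simp add: phase_slope_def flip: sine_branch_square)
  finally show ?thesis by (simp add: hermite_phase_def[abs_def] Let_def)
qed

text \<open>
  Both terms of \<open>-(2nS + 1/(2S))\<close> inherit their sign from \<open>Re S > 0\<close>. This is what makes the
  vertical direction free of backtracking.
\<close>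

lemma Re_phase_slope_neg:
  assumes "y \<in> unit_strip"
  shows "Re (phase_slope n y) < 0"
proof -
  let ?S = "sine_branch y"
  have S: "0 < Re ?S" "?S \<noteq> 0"
    using assms by (simp_all add: Re_sine_branch_pos sine_branch_nonzero)
  have "phase_slope n y = - (2 * of_nat n * ?S + inverse ?S / 2)"
    using S(2) by (simp add: phase_slope_def field_simps power2_eq_square)
  moreover have "0 < Re (inverse ?S)"
    using S(1) by (auto simp: add_pos_nonneg)
  moreover have "0 \<le> Re (2 * of_nat n * ?S)"
    using S(1) by simp
  moreover have "Re (- (2 * of_nat n * ?S + inverse ?S / 2)) =
      - (Re (2 * of_nat n * ?S) + Re (inverse ?S) / 2)"
    by (simp only: uminus_complex.sel plus_complex.sel Re_divide_numeral)
  ultimately show ?thesis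
    by (simp only: neg_less_0_iff_less)
qed

lemma Im_hermite_phase_real:
  assumes "\<bar>x\<bar> < 1"
  shows "Im (hermite_phase n (of_real x)) = 0"
proof -
  have "Arccos (of_real x) = of_real (arccos x)"
    using assms by (intro Arccos_branch(4)) auto
  then show ?thesis
    by (simp add: hermite_phase_def Let_def sin_of_real cos_of_real)
qed

text \<open>
  Along a vertical line the derivative of \<open>Im \<Phi>\<close> with respect to \<open>Im y\<close> is \<open>Re \<Phi>' < 0\<close>, and
  \<open>Im \<Phi> = 0\<close> on the real axis. Hence \<open>Im \<Phi>\<close> moves monotonically away from zero.
\<close>

lemma Im_hermite_phase_vertical:
  assumes y: "y \<in> unit_strip" and s: "s \<in> closed_segment (of_real (Re y)) y"
  shows "\<bar>Im (hermite_phase n s)\<bar> + \<bar>Im (hermite_phase n y) - Im (hermite_phase n s)\<bar>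
    \<le> \<bar>Im (hermite_phase n y)\<bar>"
proof -
  define g where "g t = Im (hermite_phase n (of_real (Re y) + \<i> * of_real t))" for t
  have "(g has_real_derivative Re (phase_slope n (of_real (Re y) + \<i> * of_real t))) (at t)" for t
  proof -
    have in_strip: "of_real (Re y) + \<i> * of_real t \<in> unit_strip"
      using y by (simp add: unit_strip_def)
    have "((\<lambda>t. of_real (Re y) + \<i> * of_real t) has_vector_derivative \<i>) (at t)"
      by (auto intro!: derivative_eq_intros)
    from has_field_derivative_Im[OF field_vector_diff_chain_at[OF this hermite_phase_derivative[OF in_strip]]]
    show ?thesis
      unfolding g_def o_def by simp
  qed
  moreover have "Re (phase_slope n (of_real (Re y) + \<i> * of_real t)) \<le> 0" for t
    using y by (intro less_imp_le Re_phase_slope_neg) (simp add: unit_strip_def)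
  ultimately have dec: "g b \<le> g a" if "a \<le> b" for a b
    using DERIV_nonpos_imp_nonincreasing[OF that, of g] by blast
  have g0: "g 0 = 0"
    using y by (simp add: g_def Im_hermite_phase_real unit_strip_def)
  have "Re s = Re y" and "Im s \<in> closed_segment 0 (Im y)"
    using s by (auto simp: closed_segment_same_Re)
  moreover from this have "s = of_real (Re y) + \<i> * of_real (Im s)"
    by (simp add: complex_eq_iff)
  ultimately have gs: "Im (hermite_phase n s) = g (Im s)"
    by (metis g_def)
  have gy: "Im (hermite_phase n y) = g (Im y)"
    by (simp add: g_def flip: complex_eq)
  show ?thesis
    using \<open>Im s \<in> _\<close> dec[of 0 "Im s"] dec[of "Im s" "Im y"] dec[of "Im s" 0] dec[of "Im y" "Im s"] g0
    unfolding gs gy by (auto simp: closed_segment_eq_real_ivl split: if_splits)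
qed

section \<open>Hermite polynomials as coupled waves\<close>

text \<open>
  Since \<open>\<pi>\<^sub>n' = n \<pi>\<^sub>n\<^sub>-\<^sub>1\<close>, the recurrence reads \<open>\<pi>\<^sub>n' = 2 (x \<pi>\<^sub>n - \<pi>\<^sub>n\<^sub>+\<^sub>1)\<close>. Differentiating this once
  more gives Hermite's equation.
\<close>

lemma hermite_ode:
  "poly (pderiv (pderiv (monic_hermite n))) x =
    2 * x * poly (pderiv (monic_hermite n)) x - 2 * of_nat n * poly (monic_hermite n) x"
proof -
  have first: "pderiv (monic_hermite n) = smult 2 ([:0, 1:] * monic_hermite n - monic_hermite (Suc n))" for n
  proof (cases n)
    case (Suc k)
    show ?thesis
      unfolding Suc pderiv_monic_hermite by (simp add: algebra_simps smult_diff_right add_divide_distrib)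
  qed simp
  have "pderiv (pderiv (monic_hermite n)) =
      smult 2 (monic_hermite n + [:0, 1:] * pderiv (monic_hermite n) - smult (of_nat (Suc n)) (monic_hermite n))"
    by (subst first) (simp only: pderiv_diff pderiv_mult pderiv_smult pderiv_monic_hermite, simp add: pderiv_pCons add.commute)
  then show ?thesis by (simp add: algebra_simps)
qed

definition hermite_scale :: "nat \<Rightarrow> real" where
  "hermite_scale n = (real n / (2 * exp 1)) powr (real n / 2)"

definition hermite_weight :: "nat \<Rightarrow> complex \<Rightarrow> complex" where
  "hermite_weight n y =
    (1 - y\<^sup>2) powr (1 / 4) * exp (- (of_nat n * y\<^sup>2)) / of_real (hermite_scale n)"

text \<open>
  The function \<open>X\<close>, whose approximation by \<open>cos \<Phi> + sin \<Phi>\<close> is to be proved. Its derivative is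
  \<open>hermite_wave_slope\<close>, written out because it has to be differentiated again.
\<close>

definition hermite_wave :: "nat \<Rightarrow> complex \<Rightarrow> complex" where
  "hermite_wave n y =
    hermite_weight n y * poly (monic_hermite n) (of_real (sqrt (2 * real n)) * y)"

text \<open>
  The negative logarithmic derivative of the weight.
\<close>

definition log_weight_slope :: "nat \<Rightarrow> complex \<Rightarrow> complex" where
  "log_weight_slope n y = 2 * of_nat n * y + y / (2 * (sine_branch y)\<^sup>2)"

definition hermite_wave_slope :: "nat \<Rightarrow> complex \<Rightarrow> complex" where
  "hermite_wave_slope n y = hermite_weight n y *
    (of_real (sqrt (2 * real n)) * poly (pderiv (monic_hermite n)) (of_real (sqrt (2 * real n)) * y)
     - log_weight_slope n y * poly (monic_hermite n) (of_real (sqrt (2 * real n)) * y))"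

text \<open>
  The function \<open>Y = X' / (\<i>\<Phi>')\<close>. For \<open>X = exp(\<plusminus>\<i>\<Phi>)\<close> it would be \<open>\<plusminus>X\<close>, so half the sum
  and half the difference of \<open>X\<close> and \<open>Y\<close> separate the two waves.
\<close>

definition hermite_cowave :: "nat \<Rightarrow> complex \<Rightarrow> complex" where
  "hermite_cowave n y = hermite_wave_slope n y / (\<i> * phase_slope n y)"

lemma hermite_weight_derivative:
  assumes "y \<in> unit_strip"
  shows "(hermite_weight n has_field_derivative - log_weight_slope n y * hermite_weight n y) (at y)"
proof -
  have y: "1 - y\<^sup>2 \<notin> \<real>\<^sub>\<le>\<^sub>0" using one_minus_square_not_nonpos[OF assms] .
  then have nz: "1 - y\<^sup>2 \<noteq> 0" by auto
  have "((\<lambda>y. (1 - y\<^sup>2) powr (1 / 4) * exp (- (of_nat n * y\<^sup>2)) / of_real (hermite_scale n))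
      has_field_derivative ((1 - y\<^sup>2) powr (1 / 4) * (- (of_nat n * (2 * y)) * exp (- (of_nat n * y\<^sup>2)))
      + 1 / 4 * (1 - y\<^sup>2) powr (1 / 4 - 1) * (- (2 * y)) * exp (- (of_nat n * y\<^sup>2)))
      / of_real (hermite_scale n)) (at y)"
    by (rule DERIV_cdivide) (use y in \<open>auto intro!: derivative_eq_intros\<close>)
  also have "(1 - y\<^sup>2) powr (1 / 4 - 1) = (1 - y\<^sup>2) powr (1 / 4) / (1 - y\<^sup>2)"
    using nz by (subst powr_diff) auto
  also have "((1 - y\<^sup>2) powr (1 / 4) * (- (of_nat n * (2 * y)) * exp (- (of_nat n * y\<^sup>2)))
      + 1 / 4 * ((1 - y\<^sup>2) powr (1 / 4) / (1 - y\<^sup>2)) * (- (2 * y)) * exp (- (of_nat n * y\<^sup>2)))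
      / of_real (hermite_scale n) = - log_weight_slope n y * hermite_weight n y"
  proof -
    have "(p * (- (m * (2 * y)) * e) + 1 / 4 * (p / d) * (- (2 * y)) * e) / c =
        - (2 * m * y + y / (2 * d)) * (p * e / c)" if "d \<noteq> 0" for p m e d c :: complex
      using that by (cases "c = 0") (simp_all add: field_simps)
    from this[OF nz] show ?thesis
      unfolding log_weight_slope_def hermite_weight_def sine_branch_square .
  qed
  finally show ?thesis by (simp add: hermite_weight_def[abs_def])
qed

lemma phase_slope_nonzero: "y \<in> unit_strip \<Longrightarrow> phase_slope n y \<noteq> 0"
  using Re_phase_slope_neg[of y n] by auto

lemma phase_slope_derivative:
  assumes y: "y \<in> unit_strip"
  shows "(phase_slope n has_field_derivative
    y * (4 * of_nat n * (sine_branch y)\<^sup>2 - 1) / (2 * sine_branch y ^ 3)) (at y)"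
proof -
  let ?S = "sine_branch y"
  have nz: "?S \<noteq> 0" by (rule sine_branch_nonzero[OF y])
  have "((\<lambda>y. - (4 * of_nat n * (sine_branch y)\<^sup>2 + 1) / (2 * sine_branch y)) has_field_derivative
      (- (4 * of_nat n * (2 * ?S * (- y / ?S))) * (2 * ?S) -
       - (4 * of_nat n * ?S\<^sup>2 + 1) * (2 * (- y / ?S))) / (2 * ?S * (2 * ?S))) (at y)"
    using nz by (auto intro!: derivative_eq_intros sine_branch_derivative[OF y])
  also have "(- (4 * of_nat n * (2 * ?S * (- y / ?S))) * (2 * ?S) -
       - (4 * of_nat n * ?S\<^sup>2 + 1) * (2 * (- y / ?S))) / (2 * ?S * (2 * ?S))
     = y * (4 * of_nat n * ?S\<^sup>2 - 1) / (2 * ?S ^ 3)"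
    using nz by (simp add: field_simps power2_eq_square power3_eq_cube)
  finally show ?thesis by (simp add: phase_slope_def[abs_def])
qed

lemma log_weight_slope_derivative:
  assumes y: "y \<in> unit_strip"
  shows "(log_weight_slope n has_field_derivative
    2 * of_nat n + 1 / (2 * (sine_branch y)\<^sup>2) + y\<^sup>2 / sine_branch y ^ 4) (at y)"
proof -
  let ?S = "sine_branch y"
  have nz: "?S \<noteq> 0" by (rule sine_branch_nonzero[OF y])
  have "((\<lambda>y. 2 * of_nat n * y + y / (2 * (sine_branch y)\<^sup>2)) has_field_derivative
      2 * of_nat n + (2 * ?S\<^sup>2 - y * (2 * (2 * ?S * (- y / ?S)))) / (2 * ?S\<^sup>2 * (2 * ?S\<^sup>2))) (at y)"
    using nz by (auto intro!: derivative_eq_intros sine_branch_derivative[OF y])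
  also have "2 * of_nat n + (2 * ?S\<^sup>2 - y * (2 * (2 * ?S * (- y / ?S)))) / (2 * ?S\<^sup>2 * (2 * ?S\<^sup>2)) =
      2 * of_nat n + 1 / (2 * ?S\<^sup>2) + y\<^sup>2 / ?S ^ 4"
    using nz by (simp add: field_simps power2_eq_square power4_eq_xxxx)
  finally show ?thesis by (simp add: log_weight_slope_def[abs_def])
qed

lemma hermite_wave_derivative:
  assumes y: "y \<in> unit_strip"
  shows "(hermite_wave n has_field_derivative \<i> * phase_slope n y * hermite_cowave n y) (at y)"
proof -
  have "((\<lambda>y. hermite_weight n y * poly (monic_hermite n) (of_real (sqrt (2 * real n)) * y))
      has_field_derivative hermite_wave_slope n y) (at y)"
    unfolding hermite_wave_slope_def
    by (rule derivative_eq_intros hermite_weight_derivative[OF y] DERIV_chain2[OF poly_DERIV] refl)+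
      (simp add: algebra_simps)
  then show ?thesis
    using phase_slope_nonzero[OF y] by (simp add: hermite_wave_def[abs_def] hermite_cowave_def)
qed

text \<open>
  The squared frequency \<open>4n\<^sup>2S\<^sup>2 + 2n\<close> of the scaled Hermite equation equals \<open>\<Phi>'\<^sup>2 - 1/(4S\<^sup>2)\<close>. Thus all terms growing with
  \<open>n\<close> are collected in \<open>\<Phi>'\<^sup>2\<close>, and the remaining potential does not depend on \<open>n\<close>.
\<close>

lemma hermite_wave_slope_derivative:
  assumes y: "y \<in> unit_strip"
  shows "(hermite_wave_slope n has_field_derivative
      - (y / (sine_branch y)\<^sup>2) * hermite_wave_slope n y
      - ((phase_slope n y)\<^sup>2 + 1 / (4 * (sine_branch y)\<^sup>2) + 5 * y\<^sup>2 / (4 * sine_branch y ^ 4)) * hermite_wave n y)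
      (at y)"
proof -
  let ?S = "sine_branch y" and ?F = "hermite_weight n y" and ?l = "log_weight_slope n y"
    and ?\<psi> = "phase_slope n y"
  define c where "c = complex_of_real (sqrt (2 * real n))"
  define P where "P = poly (monic_hermite n) (c * y)"
  define P' where "P' = poly (pderiv (monic_hermite n)) (c * y)"
  define l' where "l' = 2 * of_nat n + 1 / (2 * ?S\<^sup>2) + y\<^sup>2 / ?S ^ 4"
  have nz: "?S \<noteq> 0" by (rule sine_branch_nonzero[OF y])
  have c: "c * c = 2 * of_nat n"
    by (simp only: c_def of_real_mult[symmetric]) simp
  have "(hermite_wave_slope n has_field_derivative
      ?F * (c * (c * (2 * (c * y) * P' - 2 * of_nat n * P)) - (?l * (c * P') + l' * P))
      + - ?l * ?F * (c * P' - ?l * P)) (at y)"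
    unfolding hermite_wave_slope_def[abs_def] P_def P'_def l'_def hermite_ode[symmetric] c_def
    by (rule derivative_eq_intros hermite_weight_derivative[OF y] log_weight_slope_derivative[OF y]
          DERIV_chain2[OF poly_DERIV] refl)+
      (simp add: algebra_simps)
  also have "?F * (c * (c * (2 * (c * y) * P' - 2 * of_nat n * P)) - (?l * (c * P') + l' * P))
      + - ?l * ?F * (c * P' - ?l * P) =
      ?F * (((c * c) * 2 * y - 2 * ?l) * (c * P') + (?l\<^sup>2 - l' - (c * c) * (2 * of_nat n)) * P)"
    by (simp add: algebra_simps power2_eq_square)
  also have "\<dots> = - (y / ?S\<^sup>2) * (?F * (c * P' - ?l * P)) +
      (?l\<^sup>2 - y / ?S\<^sup>2 * ?l - l' - 4 * (of_nat n)\<^sup>2) * (?F * P)"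
    unfolding c log_weight_slope_def by (simp add: algebra_simps power2_eq_square)
  also have "?l\<^sup>2 - y / ?S\<^sup>2 * ?l - l' - 4 * (of_nat n)\<^sup>2 =
      - ((phase_slope n y)\<^sup>2 + 1 / (4 * ?S\<^sup>2) + 5 * y\<^sup>2 / (4 * ?S ^ 4))"
  proof -
    \<comment> \<open>In terms of \<open>t\<close> both sides are polynomials, and \<open>S\<^sup>2 = 1 - y\<^sup>2\<close> is used only in \<open>\<psi>\<close>.\<close>
    define t where "t = 1 / ?S\<^sup>2"
    have t: "y / ?S\<^sup>2 = y * t" "y / (2 * ?S\<^sup>2) = y * t / 2" "1 / (2 * ?S\<^sup>2) = t / 2" "1 / (4 * ?S\<^sup>2) = t / 4"
        "y\<^sup>2 / ?S ^ 4 = y\<^sup>2 * t\<^sup>2" "5 * y\<^sup>2 / (4 * ?S ^ 4) = 5 * y\<^sup>2 * t\<^sup>2 / 4"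
      by (simp_all add: t_def power_divide flip: power_mult)
    have "?\<psi>\<^sup>2 = 4 * (of_nat n)\<^sup>2 * ?S\<^sup>2 + 2 * of_nat n + t / 4"
      unfolding phase_slope_def t_def using nz
      by (simp add: power_divide divide_simps) (simp add: algebra_simps power2_eq_square)
    then have \<psi>: "?\<psi>\<^sup>2 = 4 * (of_nat n)\<^sup>2 * (1 - y\<^sup>2) + 2 * of_nat n + t / 4"
      by (simp only: sine_branch_square)
    have "?l\<^sup>2 - y / ?S\<^sup>2 * ?l - l' - 4 * (of_nat n)\<^sup>2 =
        (2 * of_nat n * y + y * t / 2)\<^sup>2 - y * t * (2 * of_nat n * y + y * t / 2)
        - (2 * of_nat n + t / 2 + y\<^sup>2 * t\<^sup>2) - 4 * (of_nat n)\<^sup>2"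
      unfolding log_weight_slope_def l'_def t ..
    also have "\<dots> = - (?\<psi>\<^sup>2 + t / 4 + 5 * y\<^sup>2 * t\<^sup>2 / 4)"
      unfolding \<psi> by (simp add: algebra_simps power2_eq_square)
    also have "\<dots> = - (?\<psi>\<^sup>2 + 1 / (4 * ?S\<^sup>2) + 5 * y\<^sup>2 / (4 * ?S ^ 4))"
      unfolding t ..
    finally show ?thesis .
  qed
  also have "- (y / ?S\<^sup>2) * (?F * (c * P' - ?l * P)) +
        - (?\<psi>\<^sup>2 + 1 / (4 * ?S\<^sup>2) + 5 * y\<^sup>2 / (4 * ?S ^ 4)) * (?F * P) =
      - (y / ?S\<^sup>2) * hermite_wave_slope n y
        - (?\<psi>\<^sup>2 + 1 / (4 * ?S\<^sup>2) + 5 * y\<^sup>2 / (4 * ?S ^ 4)) * hermite_wave n y"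
    unfolding hermite_wave_slope_def hermite_wave_def P_def P'_def c_def
    by (simp only: mult_minus_left add_uminus_conv_diff)
  finally show ?thesis .
qed

text \<open>
  Half of what is left of \<open>Y'\<close> after subtracting \<open>\<i>\<Phi>' X\<close>. The denominator \<open>4nS\<^sup>2 + 1\<close> makes it
  \<open>O(1/n)\<close>.
\<close>

definition wave_coupling :: "nat \<Rightarrow> complex \<Rightarrow> complex" where
  "wave_coupling n y = - (\<i> * sine_branch y *
      (1 / (2 * (sine_branch y)\<^sup>2) + 5 * y\<^sup>2 / (2 * sine_branch y ^ 4)) * hermite_wave n y
      + 2 * y / (sine_branch y)\<^sup>2 * hermite_cowave n y) / (2 * (4 * of_nat n * (sine_branch y)\<^sup>2 + 1))"

text \<open>
  The coefficient of \<open>Y\<close> in \<open>Y'\<close> is \<open>-y/S\<^sup>2 - \<Phi>''/\<Phi>'\<close>. Its terms of order one cancel because the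
  weight \<open>(1 - y\<^sup>2)\<^sup>1\<^sup>/\<^sup>4\<close> compensates the variation of the amplitude \<open>\<bar>\<Phi>'\<bar>\<^sup>-\<^sup>1\<^sup>/\<^sup>2\<close> to leading
  order.
\<close>

lemma hermite_cowave_derivative:
  assumes y: "y \<in> unit_strip"
  shows "(hermite_cowave n has_field_derivative
    \<i> * phase_slope n y * hermite_wave n y + 2 * wave_coupling n y) (at y)"
proof -
  let ?S = "sine_branch y" and ?Z = "hermite_wave_slope n y" and ?\<psi> = "phase_slope n y"
  let ?X = "hermite_wave n y" and ?Y = "hermite_cowave n y"
  let ?h = "1 / (4 * ?S\<^sup>2) + 5 * y\<^sup>2 / (4 * ?S ^ 4)"
  let ?\<psi>' = "y * (4 * of_nat n * ?S\<^sup>2 - 1) / (2 * ?S ^ 3)"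
  define w where "w = 4 * of_nat n * ?S\<^sup>2 + 1"
  have nz: "?S \<noteq> 0" "?\<psi> \<noteq> 0" by (rule sine_branch_nonzero[OF y] phase_slope_nonzero[OF y])+
  have \<psi>: "?\<psi> = - w / (2 * ?S)" by (simp add: phase_slope_def w_def)
  have w: "w \<noteq> 0" using nz by (auto simp: \<psi>)
  have \<psi>': "?\<psi>' = y * (w - 2) / (2 * ?S ^ 3)" by (simp add: w_def)
  let ?Z' = "- (y / ?S\<^sup>2) * ?Z - (?\<psi>\<^sup>2 + 1 / (4 * ?S\<^sup>2) + 5 * y\<^sup>2 / (4 * ?S ^ 4)) * ?X"
  have "((\<lambda>y. hermite_wave_slope n y / (\<i> * phase_slope n y)) has_field_derivative
      (?Z' * (\<i> * ?\<psi>) - ?Z * (\<i> * ?\<psi>')) / (\<i> * ?\<psi> * (\<i> * ?\<psi>))) (at y)"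
    by (rule DERIV_divide hermite_wave_slope_derivative[OF y] DERIV_cmult phase_slope_derivative[OF y])+
      (use nz in auto)
  also have "(?Z' * (\<i> * ?\<psi>) - ?Z * (\<i> * ?\<psi>')) / (\<i> * ?\<psi> * (\<i> * ?\<psi>)) =
      ?Z' / (\<i> * ?\<psi>) - ?Y * (?\<psi>' / ?\<psi>)"
    using nz(2) by (simp add: hermite_cowave_def diff_divide_distrib)
  also have "?Z' / (\<i> * ?\<psi>) = - (y / ?S\<^sup>2) * ?Y + \<i> * ?\<psi> * ?X + \<i> * ?h * ?X * (1 / ?\<psi>)"
  proof -
    have "(- a * Z - (p\<^sup>2 + b + d) * X) / (\<i> * p) = - a * (Z / (\<i> * p)) + \<i> * p * X + \<i> * (b + d) * X * (1 / p)"
      if "p \<noteq> 0" for a Z p b d X :: complex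
      using that by (simp add: divide_simps) (simp add: algebra_simps power2_eq_square)
    from this[OF nz(2)] show ?thesis unfolding hermite_cowave_def .
  qed
  also have "1 / ?\<psi> = - 2 * ?S / w"
    by (simp add: \<psi>)
  also have "?\<psi>' / ?\<psi> = - (y / ?S\<^sup>2) + 2 * y / (?S\<^sup>2 * w)"
    unfolding \<psi>' \<psi> using nz(1) w by (simp add: divide_simps) (simp add: algebra_simps power2_eq_square power3_eq_cube)
  also have "- (y / ?S\<^sup>2) * ?Y + \<i> * ?\<psi> * ?X + \<i> * ?h * ?X * (- 2 * ?S / w)
      - ?Y * (- (y / ?S\<^sup>2) + 2 * y / (?S\<^sup>2 * w)) =
      \<i> * ?\<psi> * ?X - (\<i> * ?S * (2 * ?h) * ?X + 2 * y / ?S\<^sup>2 * ?Y) / w"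
    by (simp add: algebra_simps add_divide_distrib)
  also have "2 * ?h = 1 / (2 * ?S\<^sup>2) + 5 * y\<^sup>2 / (2 * ?S ^ 4)"
    by simp
  also have "\<i> * ?\<psi> * ?X - (\<i> * ?S * (1 / (2 * ?S\<^sup>2) + 5 * y\<^sup>2 / (2 * ?S ^ 4)) * ?X + 2 * y / ?S\<^sup>2 * ?Y) / w =
      \<i> * ?\<psi> * ?X + 2 * wave_coupling n y"
  proof -
    have "a - b / c = a + 2 * (- b / (2 * c))" for a b c :: complex by simp
    then show ?thesis unfolding wave_coupling_def w_def .
  qed
  finally show ?thesis by (simp add: hermite_cowave_def[abs_def])
qed

text \<open>
  The real part of \<open>S\<^sup>2 = 1 - y\<^sup>2\<close> is at least \<open>1 - (Re y)\<^sup>2 \<ge> s\<close>. This keeps \<open>S\<close> away from zero and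
  makes the denominator \<open>4nS\<^sup>2 + 1\<close> at least \<open>4ns\<close> in norm.
\<close>

lemma wave_coupling_bound:
  assumes s: "0 < s" "s \<le> 1 - (Re y)\<^sup>2" and y: "\<bar>Im y\<bar> < 1" and n: "1 \<le> n"
  shows "norm (wave_coupling n y) \<le> (5 / s + 20 / s\<^sup>2) / (8 * real n * s) *
    (norm ((hermite_wave n y + hermite_cowave n y) / 2) + norm ((hermite_wave n y - hermite_cowave n y) / 2))"
proof -
  let ?S = "sine_branch y" and ?X = "hermite_wave n y" and ?Y = "hermite_cowave n y"
  define a where "a = \<i> * ?S * (1 / (2 * ?S\<^sup>2) + 5 * y\<^sup>2 / (2 * ?S ^ 4))"
  define b where "b = 2 * y / ?S\<^sup>2"
  define w where "w = 4 * of_nat n * ?S\<^sup>2 + 1"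
  let ?N = "norm ((?X + ?Y) / 2) + norm ((?X - ?Y) / 2)"
  have "Re (?S\<^sup>2) = 1 - (Re y)\<^sup>2 + (Im y)\<^sup>2"
    by (simp add: sine_branch_square Re_power2)
  then have Re_S: "s \<le> Re (?S\<^sup>2)" using s by (smt (verit) zero_le_power2)
  then have S2: "s \<le> norm (?S\<^sup>2)" by (rule order_trans[OF _ complex_Re_le_cmod])
  have "(Re y)\<^sup>2 \<le> 1" using s by linarith
  moreover have "(Im y)\<^sup>2 \<le> 1" using y abs_square_le_1[of "Im y"] by simp
  ultimately have y2: "norm (y\<^sup>2) \<le> 2" by (simp add: norm_power cmod_power2)
  then have y1: "norm y \<le> 2"
    using power2_le_imp_le[of "norm y" 2] by (simp add: norm_power)
  have "norm (?S\<^sup>2) \<le> 2\<^sup>2"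
    using norm_triangle_ineq4[of 1 "y\<^sup>2"] y2 by (simp add: sine_branch_square)
  then have S1: "norm ?S \<le> 2"
    by (simp only: norm_power) (rule power2_le_imp_le, auto)
  have "norm a \<le> 1 / s + 20 / s\<^sup>2"
  proof -
    have "norm a = norm ?S * norm (1 / (2 * ?S\<^sup>2) + 5 * y\<^sup>2 / (2 * ?S ^ 4))"
      by (simp add: a_def norm_mult)
    also have "\<dots> \<le> 2 * (1 / (2 * s) + 5 * 2 / (2 * s\<^sup>2))"
    proof (intro mult_mono S1 order_trans[OF norm_triangle_ineq] add_mono)
      show "norm (1 / (2 * ?S\<^sup>2)) \<le> 1 / (2 * s)"
        using S2 s by (simp add: norm_divide norm_mult frac_le)
      have "s\<^sup>2 \<le> norm (?S ^ 4)"
        using power_mono[OF S2, of 2] s by (simp add: norm_power flip: power_mult)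
      then show "norm (5 * y\<^sup>2 / (2 * ?S ^ 4)) \<le> 5 * 2 / (2 * s\<^sup>2)"
        unfolding norm_divide norm_mult
        by (intro frac_le mult_mono) (use s y2 in auto)
    qed auto
    also have "\<dots> \<le> 1 / s + 20 / s\<^sup>2"
      using s by (simp add: field_simps)
    finally show ?thesis .
  qed
  moreover have "norm b \<le> 4 / s"
    unfolding b_def norm_divide norm_mult
    by (intro frac_le) (use s y1 S2 in auto)
  ultimately have ab: "norm a + norm b \<le> 5 / s + 20 / s\<^sup>2" by (simp add: add_divide_distrib)
  have "4 * real n * s \<le> 4 * real n * Re (?S\<^sup>2)"
    using Re_S by (intro mult_left_mono) auto
  also have "\<dots> \<le> Re w"
    by (simp add: w_def)
  also have "\<dots> \<le> norm w" by (rule complex_Re_le_cmod)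
  finally have w: "4 * real n * s \<le> norm w" .
  have X: "norm ?X \<le> ?N"
    using norm_triangle_ineq[of "(?X + ?Y) / 2" "(?X - ?Y) / 2"] by (simp add: field_simps)
  have Y: "norm ?Y \<le> ?N"
    using norm_triangle_ineq4[of "(?X + ?Y) / 2" "(?X - ?Y) / 2"] by (simp add: field_simps)
  have "norm (a * ?X + b * ?Y) \<le> norm a * ?N + norm b * ?N"
    using X Y by (intro order_trans[OF norm_triangle_ineq] add_mono) (simp_all only: norm_mult mult_left_mono norm_ge_zero)
  also have "\<dots> = (norm a + norm b) * ?N" by (simp only: ring_distribs)
  also have "\<dots> \<le> (5 / s + 20 / s\<^sup>2) * ?N"
    by (intro mult_right_mono ab) auto
  finally have num: "norm (a * ?X + b * ?Y) \<le> (5 / s + 20 / s\<^sup>2) * ?N" .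
  have "wave_coupling n y = - (a * ?X + b * ?Y) / (2 * w)"
    by (simp add: wave_coupling_def a_def b_def w_def)
  then have "norm (wave_coupling n y) = norm (a * ?X + b * ?Y) / (2 * norm w)"
    by (simp only: norm_divide norm_minus_cancel norm_mult) simp
  also have "\<dots> \<le> ((5 / s + 20 / s\<^sup>2) * ?N) / (2 * (4 * real n * s))"
    using num w s n by (intro frac_le mult_nonneg_nonneg add_nonneg_nonneg) (simp_all add: mult_ac)
  finally show ?thesis by (simp add: mult_ac)
qed

section \<open>Propagation from the origin\<close>

definition forward_wave :: "nat \<Rightarrow> complex \<Rightarrow> complex" where
  "forward_wave n y = (hermite_wave n y + hermite_cowave n y) / 2"

definition backward_wave :: "nat \<Rightarrow> complex \<Rightarrow> complex" where
  "backward_wave n y = (hermite_wave n y - hermite_cowave n y) / 2"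

lemma forward_wave_derivative:
  "y \<in> unit_strip \<Longrightarrow> (forward_wave n has_field_derivative
    \<i> * phase_slope n y * forward_wave n y + wave_coupling n y) (at y)"
  unfolding forward_wave_def[abs_def]
  by (rule DERIV_cong[OF DERIV_cdivide[OF DERIV_add[OF hermite_wave_derivative hermite_cowave_derivative]]])
    (auto simp: add_divide_distrib diff_divide_distrib algebra_simps)

lemma backward_wave_derivative:
  "y \<in> unit_strip \<Longrightarrow> (backward_wave n has_field_derivative
    - (\<i> * phase_slope n y * backward_wave n y) - wave_coupling n y) (at y)"
  unfolding backward_wave_def[abs_def]
  by (rule DERIV_cong[OF DERIV_cdivide[OF DERIV_diff[OF hermite_wave_derivative hermite_cowave_derivative]]])
    (auto simp: add_divide_distrib diff_divide_distrib algebra_simps)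

text \<open>
  The amplitudes of the two waves, constant up to the effect of the coupling. Propagation
  transports them from one point to another.
\<close>

definition forward_amplitude :: "nat \<Rightarrow> complex \<Rightarrow> complex" where
  "forward_amplitude n y = exp (- (\<i> * hermite_phase n y)) * forward_wave n y"

definition backward_amplitude :: "nat \<Rightarrow> complex \<Rightarrow> complex" where
  "backward_amplitude n y = exp (\<i> * hermite_phase n y) * backward_wave n y"

lemma amplitude_propagation:
  assumes s: "0 < s" "\<And>z. z \<in> closed_segment p q \<Longrightarrow> s \<le> 1 - (Re z)\<^sup>2"
    and im: "\<And>z. z \<in> closed_segment p q \<Longrightarrow> \<bar>Im z\<bar> < 1"
    and mono: "\<And>r z. z \<in> closed_segment p q \<Longrightarrow> r \<in> closed_segment p z \<Longrightarrow>
      \<bar>Im (hermite_phase n r)\<bar> + \<bar>Im (hermite_phase n z) - Im (hermite_phase n r)\<bar> \<le> \<bar>Im (hermite_phase n z)\<bar>"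
    and len: "norm (q - p) \<le> 1" and n: "1 \<le> n"
    and \<kappa>: "\<kappa> = (5 / s + 20 / s\<^sup>2) / (8 * real n * s)" "4 * \<kappa> \<le> 1"
  shows "norm (forward_wave n q - exp (\<i> * hermite_phase n q) * forward_amplitude n p)
      \<le> 2 * \<kappa> * (norm (forward_amplitude n p) + norm (backward_amplitude n p)) * exp \<bar>Im (hermite_phase n q)\<bar>"
    and "norm (backward_wave n q - exp (- (\<i> * hermite_phase n q)) * backward_amplitude n p)
      \<le> 2 * \<kappa> * (norm (forward_amplitude n p) + norm (backward_amplitude n p)) * exp \<bar>Im (hermite_phase n q)\<bar>"
proof -
  have strip: "z \<in> unit_strip" if "z \<in> closed_segment p q" for z
  proof -
    have "(Re z)\<^sup>2 < 1" using s(1) s(2)[OF that] by linarith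
    then show ?thesis by (simp add: unit_strip_def abs_square_less_1)
  qed
  have bound: "norm (wave_coupling n z) \<le> \<kappa> * (norm (forward_wave n z) + norm (backward_wave n z))"
    if "z \<in> closed_segment p q" for z
    unfolding \<kappa>(1) forward_wave_def backward_wave_def
    by (rule wave_coupling_bound[OF s(1) s(2)[OF that] im[OF that] n])
  have "0 \<le> \<kappa>" using s(1) by (simp add: \<kappa>(1))
  note bounds = coupled_propagation[OF forward_wave_derivative[OF strip] backward_wave_derivative[OF strip]
      hermite_phase_derivative[OF strip] bound mono this \<kappa>(2) len]
  show "norm (forward_wave n q - exp (\<i> * hermite_phase n q) * forward_amplitude n p)
      \<le> 2 * \<kappa> * (norm (forward_amplitude n p) + norm (backward_amplitude n p)) * exp \<bar>Im (hermite_phase n q)\<bar>"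
    unfolding forward_amplitude_def backward_amplitude_def by (rule bounds(1))
  show "norm (backward_wave n q - exp (- (\<i> * hermite_phase n q)) * backward_amplitude n p)
      \<le> 2 * \<kappa> * (norm (forward_amplitude n p) + norm (backward_amplitude n p)) * exp \<bar>Im (hermite_phase n q)\<bar>"
    unfolding forward_amplitude_def backward_amplitude_def by (rule bounds(2))
qed

text \<open>
  Two applications of \<open>amplitude_propagation\<close>. The first runs along the real axis to \<open>Re y\<close>, where \<open>Im \<Phi> = 0\<close>, and
  moves the amplitudes by at most \<open>4\<kappa>\<close>, so their norms remain at most \<open>2\<close>. The second, vertical leg
  adds an error of \<open>8\<kappa>\<close> relative to \<open>exp \<bar>Im \<Phi>\<bar>\<close>.
\<close>

lemma wave_estimate:
  assumes s: "0 < s" "s \<le> 1 - (Re y)\<^sup>2" and im: "\<bar>Im y\<bar> < 1" and n: "1 \<le> n"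
    and \<kappa>: "\<kappa> = (5 / s + 20 / s\<^sup>2) / (8 * real n * s)" "4 * \<kappa> \<le> 1"
    and init: "norm (forward_amplitude n 0) \<le> 1" "norm (backward_amplitude n 0) \<le> 1"
  shows "norm (forward_wave n y - exp (\<i> * hermite_phase n y) * forward_amplitude n 0)
      \<le> 12 * \<kappa> * exp \<bar>Im (hermite_phase n y)\<bar>"
    and "norm (backward_wave n y - exp (- (\<i> * hermite_phase n y)) * backward_amplitude n 0)
      \<le> 12 * \<kappa> * exp \<bar>Im (hermite_phase n y)\<bar>"
proof -
  define x where "x = complex_of_real (Re y)"
  have \<kappa>0: "0 \<le> \<kappa>" using s(1) by (simp add: \<kappa>(1))
  have "(Re y)\<^sup>2 < 1" using s by linarith
  then have Re_y: "\<bar>Re y\<bar> < 1" by (simp add: abs_square_less_1)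
  have strip: "y \<in> unit_strip" using Re_y by (simp add: unit_strip_def)
  let ?\<Phi> = "hermite_phase n"
  have seg1: "Im z = 0 \<and> \<bar>Re z\<bar> \<le> \<bar>Re y\<bar>" if "z \<in> closed_segment 0 x" for z
    using that by (auto simp: x_def closed_segment_same_Im closed_segment_eq_real_ivl split: if_splits)
  have real_phase: "Im (?\<Phi> z) = 0" if "z \<in> closed_segment 0 x" for z
  proof -
    have "z = of_real (Re z)" "\<bar>Re z\<bar> < 1"
      using seg1[OF that] Re_y by (auto simp: complex_eq_iff)
    then show ?thesis using Im_hermite_phase_real[of "Re z" n] by simp
  qed
  have seg2: "Re z = Re y \<and> \<bar>Im z\<bar> \<le> \<bar>Im y\<bar>" if "z \<in> closed_segment x y" for z
    using that by (auto simp: x_def closed_segment_same_Re closed_segment_eq_real_ivl split: if_splits)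
  have leg1: "s \<le> 1 - (Re z)\<^sup>2" "\<bar>Im z\<bar> < 1"
      "r \<in> closed_segment 0 z \<Longrightarrow> \<bar>Im (?\<Phi> r)\<bar> + \<bar>Im (?\<Phi> z) - Im (?\<Phi> r)\<bar> \<le> \<bar>Im (?\<Phi> z)\<bar>"
    if z: "z \<in> closed_segment 0 x" for r z
  proof -
    have "(Re z)\<^sup>2 \<le> (Re y)\<^sup>2" using seg1[OF z] by (simp add: abs_le_square_iff)
    then show "s \<le> 1 - (Re z)\<^sup>2" using s(2) by linarith
    show "\<bar>Im z\<bar> < 1" using seg1[OF z] by simp
    assume "r \<in> closed_segment 0 z"
    then have "r \<in> closed_segment 0 x"
      using z by (meson ends_in_segment(1) subsetD subset_closed_segment)
    then show "\<bar>Im (?\<Phi> r)\<bar> + \<bar>Im (?\<Phi> z) - Im (?\<Phi> r)\<bar> \<le> \<bar>Im (?\<Phi> z)\<bar>"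
      using z by (simp add: real_phase)
  qed
  have "norm (x - 0) \<le> 1" using Re_y by (simp add: x_def)
  note step1 = amplitude_propagation[OF s(1) leg1 this n \<kappa>]
  have Im_x: "Im (?\<Phi> x) = 0" by (rule real_phase) simp
  have drift: "norm (forward_amplitude n x - forward_amplitude n 0) \<le> 4 * \<kappa>"
      "norm (backward_amplitude n x - backward_amplitude n 0) \<le> 4 * \<kappa>"
  proof -
    have le: "2 * \<kappa> * (norm (forward_amplitude n 0) + norm (backward_amplitude n 0)) * exp \<bar>Im (?\<Phi> x)\<bar> \<le> 4 * \<kappa>"
      using init \<kappa>0 mult_left_mono[of "norm (forward_amplitude n 0) + norm (backward_amplitude n 0)" 2 "2 * \<kappa>"]
      by (simp add: Im_x)
    have "forward_amplitude n x - forward_amplitude n 0 =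
        exp (- (\<i> * ?\<Phi> x)) * (forward_wave n x - exp (\<i> * ?\<Phi> x) * forward_amplitude n 0)"
      by (simp add: forward_amplitude_def algebra_simps exp_minus)
    then have "norm (forward_amplitude n x - forward_amplitude n 0) =
        norm (forward_wave n x - exp (\<i> * ?\<Phi> x) * forward_amplitude n 0)"
      by (simp only: norm_mult norm_exp_eq_Re) (simp add: Im_x)
    with step1(1) le show "norm (forward_amplitude n x - forward_amplitude n 0) \<le> 4 * \<kappa>" by linarith
    have "backward_amplitude n x - backward_amplitude n 0 =
        exp (\<i> * ?\<Phi> x) * (backward_wave n x - exp (- (\<i> * ?\<Phi> x)) * backward_amplitude n 0)"
      by (simp add: backward_amplitude_def algebra_simps exp_minus)
    then have "norm (backward_amplitude n x - backward_amplitude n 0) =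
        norm (backward_wave n x - exp (- (\<i> * ?\<Phi> x)) * backward_amplitude n 0)"
      by (simp only: norm_mult norm_exp_eq_Re) (simp add: Im_x)
    with step1(2) le show "norm (backward_amplitude n x - backward_amplitude n 0) \<le> 4 * \<kappa>" by linarith
  qed
  have amp_x: "norm (forward_amplitude n x) + norm (backward_amplitude n x) \<le> 4"
    using drift init \<kappa>(2) norm_triangle_sub[of "forward_amplitude n x" "forward_amplitude n 0"]
      norm_triangle_sub[of "backward_amplitude n x" "backward_amplitude n 0"] by linarith
  have leg2: "s \<le> 1 - (Re z)\<^sup>2" "\<bar>Im z\<bar> < 1"
      "r \<in> closed_segment x z \<Longrightarrow> \<bar>Im (?\<Phi> r)\<bar> + \<bar>Im (?\<Phi> z) - Im (?\<Phi> r)\<bar> \<le> \<bar>Im (?\<Phi> z)\<bar>"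
    if z: "z \<in> closed_segment x y" for r z
  proof -
    show "s \<le> 1 - (Re z)\<^sup>2" using seg2[OF z] s(2) by simp
    show "\<bar>Im z\<bar> < 1" using seg2[OF z] im by simp
    assume "r \<in> closed_segment x z"
    moreover have "z \<in> unit_strip" "x = of_real (Re z)"
      using seg2[OF z] Re_y by (simp_all add: unit_strip_def x_def)
    ultimately show "\<bar>Im (?\<Phi> r)\<bar> + \<bar>Im (?\<Phi> z) - Im (?\<Phi> r)\<bar> \<le> \<bar>Im (?\<Phi> z)\<bar>"
      by (intro Im_hermite_phase_vertical) simp_all
  qed
  have "y - x = \<i> * of_real (Im y)" by (simp add: x_def complex_eq_iff)
  then have "norm (y - x) \<le> 1" using im by (simp add: norm_mult)
  note step2 = amplitude_propagation[OF s(1) leg2 this n \<kappa>]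
  have le2: "2 * \<kappa> * (norm (forward_amplitude n x) + norm (backward_amplitude n x)) * exp \<bar>Im (?\<Phi> y)\<bar>
      \<le> 2 * \<kappa> * 4 * exp \<bar>Im (?\<Phi> y)\<bar>"
    using amp_x \<kappa>0 by (intro mult_right_mono mult_left_mono) auto
  have shift: "norm (exp (c * (\<i> * ?\<Phi> y)) * (a - b)) \<le> 4 * \<kappa> * exp \<bar>Im (?\<Phi> y)\<bar>"
    if "norm (a - b) \<le> 4 * \<kappa>" "c = 1 \<or> c = -1" for a b c
  proof -
    have "norm (exp (c * (\<i> * ?\<Phi> y))) \<le> exp \<bar>Im (?\<Phi> y)\<bar>"
      using that(2) by auto
    from mult_mono[OF this that(1)] show ?thesis by (simp add: norm_mult mult.commute)
  qed
  show "norm (forward_wave n y - exp (\<i> * ?\<Phi> y) * forward_amplitude n 0)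
      \<le> 12 * \<kappa> * exp \<bar>Im (?\<Phi> y)\<bar>"
  proof -
    have "forward_wave n y - exp (\<i> * ?\<Phi> y) * forward_amplitude n 0 =
        (forward_wave n y - exp (\<i> * ?\<Phi> y) * forward_amplitude n x) +
        exp (1 * (\<i> * ?\<Phi> y)) * (forward_amplitude n x - forward_amplitude n 0)"
      by (simp add: algebra_simps)
    also have "norm \<dots> \<le> 2 * \<kappa> * 4 * exp \<bar>Im (?\<Phi> y)\<bar> + 4 * \<kappa> * exp \<bar>Im (?\<Phi> y)\<bar>"
      by (intro order_trans[OF norm_triangle_ineq] add_mono order_trans[OF step2(1) le2] shift drift) simp_all
    finally show ?thesis by (simp add: algebra_simps)
  qed
  show "norm (backward_wave n y - exp (- (\<i> * ?\<Phi> y)) * backward_amplitude n 0)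
      \<le> 12 * \<kappa> * exp \<bar>Im (?\<Phi> y)\<bar>"
  proof -
    have "backward_wave n y - exp (- (\<i> * ?\<Phi> y)) * backward_amplitude n 0 =
        (backward_wave n y - exp (- (\<i> * ?\<Phi> y)) * backward_amplitude n x) +
        exp (- 1 * (\<i> * ?\<Phi> y)) * (backward_amplitude n x - backward_amplitude n 0)"
      by (simp add: algebra_simps)
    also have "norm \<dots> \<le> 2 * \<kappa> * 4 * exp \<bar>Im (?\<Phi> y)\<bar> + 4 * \<kappa> * exp \<bar>Im (?\<Phi> y)\<bar>"
      by (intro order_trans[OF norm_triangle_ineq] add_mono order_trans[OF step2(2) le2] shift drift) simp_all
    finally show ?thesis by (simp add: algebra_simps)
  qed
qed

section \<open>The amplitudes at the origin\<close>

text \<open>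
  The common modulus of the two amplitudes at the origin. For even \<open>n\<close> it comes from the value of
  the polynomial there, for odd \<open>n\<close> from its derivative.
\<close>

definition central_amplitude :: "nat \<Rightarrow> real" where
  "central_amplitude n = (if even n then hermite_central (n div 2) / (2 * hermite_scale n)
     else sqrt (2 * real n) * real n * hermite_central (n div 2) / ((4 * real n + 1) * hermite_scale n))"

lemma central_amplitude_limit: "central_amplitude \<longlonglongrightarrow> sqrt 2 / 2"
proof (rule tendsto_even_odd)
  let ?h = "\<lambda>m. hermite_central m / (real m / exp 1) powr real m"
  have "central_amplitude (2 * m) = ?h m / 2" for m
    by (simp add: central_amplitude_def hermite_scale_def)
  then show "(\<lambda>m. central_amplitude (2 * m)) \<longlonglongrightarrow> sqrt 2 / 2"
    by (simp only:) (intro tendsto_intros hermite_central_asymptotic, simp)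
  \<comment> \<open>Everything but the central value, with the powers written as exponentials.\<close>
  define b where "b m = sqrt (2 * real (2 * m + 1)) * real (2 * m + 1) / (4 * real (2 * m + 1) + 1) *
      exp (real m * (ln (real m) - 1) - real (2 * m + 1) / 2 * (ln (real (2 * m + 1) / 2) - 1))" for m
  have "b \<longlonglongrightarrow> 1 / 2"
    unfolding b_def by real_asymp
  with hermite_central_asymptotic have "(\<lambda>m. ?h m * b m) \<longlonglongrightarrow> sqrt 2 * (1 / 2)"
    by (rule tendsto_mult)
  moreover have "eventually (\<lambda>m. ?h m * b m = central_amplitude (2 * m + 1)) sequentially"
    using eventually_gt_at_top[of 0]
  proof eventually_elim
    case (elim m)
    define k where "k = real (2 * m + 1)"
    have "0 < k" by (simp add: k_def)
    have "ln (k / (2 * exp 1)) = ln (k / 2) - 1"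
      using \<open>0 < k\<close> by (simp add: ln_div ln_mult)
    then have scale: "hermite_scale (2 * m + 1) = exp (k / 2 * (ln (k / 2) - 1))"
      using \<open>0 < k\<close> unfolding hermite_scale_def k_def[symmetric] by (simp add: powr_def)
    have "(real m / exp 1) powr real m = exp (real m * (ln (real m) - 1))"
      using elim by (simp add: powr_def ln_div)
    moreover have "central_amplitude (2 * m + 1) =
        sqrt (2 * k) * k * hermite_central m / ((4 * k + 1) * hermite_scale (2 * m + 1))"
      by (simp add: central_amplitude_def k_def)
    ultimately show ?case
      unfolding b_def scale k_def[symmetric] exp_diff by simp
  qed
  ultimately show "(\<lambda>m. central_amplitude (2 * m + 1)) \<longlonglongrightarrow> sqrt 2 / 2"
    by (simp add: filterlim_cong)
qed

text \<open>
  At the origin \<open>\<Phi> = n\<pi>/2 + \<pi>/4\<close>, and the factor \<open>(\<plusminus>\<i>)\<^sup>n\<close> in \<open>exp(\<plusminus>\<i>\<Phi>)\<close> matches the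
  alternating signs of the central values, which leaves only the shift by \<open>\<pi>/4\<close>.
\<close>

lemma central_amplitudes:
  "forward_amplitude n 0 = of_real (central_amplitude n) * exp (- (\<i> * of_real (pi / 4)))" (is ?F)
  "backward_amplitude n 0 = of_real (central_amplitude n) * exp (\<i> * of_real (pi / 4))" (is ?B)
proof -
  let ?e = "exp (\<i> * of_real (pi / 4))" and ?e' = "exp (- (\<i> * of_real (pi / 4)))"
  define m where "m = n div 2"
  have S: "sine_branch 0 = 1" by (simp add: sine_branch_def)
  have slope: "phase_slope n 0 = - (4 * of_nat n + 1) / 2"
    by (simp add: phase_slope_def S)
  have phase: "hermite_phase n 0 = of_real (real n * (pi / 2) + pi / 4)"
    by (simp add: hermite_phase_def Let_def)
  have wave: "hermite_wave n 0 = poly (monic_hermite n) 0 / of_real (hermite_scale n)"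
    by (simp add: hermite_wave_def hermite_weight_def)
  have cowave: "hermite_cowave n 0 = of_real (sqrt (2 * real n)) * poly (pderiv (monic_hermite n)) 0
      / of_real (hermite_scale n) / (\<i> * (- (4 * of_nat n + 1) / 2))"
    by (simp add: hermite_cowave_def hermite_wave_slope_def hermite_weight_def log_weight_slope_def slope)
  have nz: "4 * complex_of_nat n + 1 \<noteq> 0"
    by (metis add_eq_0_iff_both_eq_0 of_nat_1 of_nat_add of_nat_eq_0_iff of_nat_mult of_nat_numeral zero_neq_one)
  have powers: "exp (\<i> * of_real (real m * pi + t)) = (- 1) ^ m * exp (\<i> * of_real t)"
      "exp (- (\<i> * of_real (real m * pi + t))) = (- 1) ^ m * exp (- (\<i> * of_real t))" for t
  proof -
    have "\<i> * of_real (real m * pi) = of_nat m * (of_real pi * \<i>)" by simp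
    then have m: "exp (\<i> * of_real (real m * pi)) = (- 1) ^ m"
      by (simp only: exp_of_nat_mult exp_pi_i)
    show "exp (\<i> * of_real (real m * pi + t)) = (- 1) ^ m * exp (\<i> * of_real t)"
      by (simp only: of_real_add distrib_left exp_add m)
    show "exp (- (\<i> * of_real (real m * pi + t))) = (- 1) ^ m * exp (- (\<i> * of_real t))"
      by (simp only: of_real_add distrib_left exp_add m exp_minus inverse_mult_distrib)
        (simp flip: power_inverse)
  qed
  have sq: "(- 1) ^ m * ((- 1) ^ m * w) = w" for w :: complex
    by (simp flip: mult.assoc power_mult_distrib)
  show ?F ?B
  proof (atomize (full), cases "even n")
    case True
    then have n: "n = 2 * m" by (simp add: m_def)
    have "poly (pderiv (monic_hermite n)) 0 = 0"
    proof (cases m)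
      case (Suc k)
      then have "n = Suc (2 * k + 1)" by (simp add: n)
      then show ?thesis using poly_monic_hermite_zero_odd[of k] by (simp add: pderiv_monic_hermite del: monic_hermite.simps)
    qed (simp add: n)
    moreover have "poly (monic_hermite n) 0 = (- 1) ^ m * of_real (hermite_central m)"
      unfolding n by (rule poly_monic_hermite_zero_even)
    moreover have "hermite_phase n 0 = of_real (real m * pi + pi / 4)"
      unfolding phase by (simp add: n)
    moreover have "central_amplitude n = hermite_central m / (2 * hermite_scale n)"
      using True by (simp add: central_amplitude_def m_def)
    ultimately have wave0: "hermite_wave n 0 = (- 1) ^ m * (2 * of_real (central_amplitude n))"
        and cowave0: "hermite_cowave n 0 = 0" and ph: "hermite_phase n 0 = of_real (real m * pi + pi / 4)"
      by (simp_all add: wave cowave)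
    have "forward_amplitude n 0 = (- 1) ^ m * ((- 1) ^ m * (of_real (central_amplitude n) * ?e'))"
      unfolding forward_amplitude_def forward_wave_def wave0 cowave0 ph powers by (simp only: mult_ac) simp
    moreover have "backward_amplitude n 0 = (- 1) ^ m * ((- 1) ^ m * (of_real (central_amplitude n) * ?e))"
      unfolding backward_amplitude_def backward_wave_def wave0 cowave0 ph powers by (simp only: mult_ac) simp
    ultimately show "?F \<and> ?B" by (simp only: sq)
  next
    case False
    then have n: "n = Suc (2 * m)" by (simp add: m_def)
    have "poly (monic_hermite n) 0 = 0"
      using poly_monic_hermite_zero_odd[of m] by (simp add: n)
    then have wave0: "hermite_wave n 0 = 0" by (simp add: wave)
    have pderiv0: "poly (pderiv (monic_hermite n)) 0 = of_nat n * ((- 1) ^ m * of_real (hermite_central m))"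
      unfolding n pderiv_monic_hermite poly_smult poly_monic_hermite_zero_even ..
    have cowave0: "hermite_cowave n 0 = (- 1) ^ m * (2 * \<i> * of_real (central_amplitude n))"
    proof -
      have rearrange: "c * (k * (t * q)) / h / (\<i> * (- w / 2)) = t * (2 * \<i> * (c * k * q / (w * h)))"
        for c k t q h w :: complex
        by (cases "w = 0 \<or> h = 0") (auto simp: divide_simps mult_ac)
      have amplitude: "complex_of_real (central_amplitude n) = of_real (sqrt (2 * real n)) * of_nat n *
          of_real (hermite_central m) / ((4 * of_nat n + 1) * of_real (hermite_scale n))"
        using False by (simp add: central_amplitude_def flip: m_def)
      show ?thesis
        unfolding cowave pderiv0 amplitude by (rule rearrange)
    qed
    have ph: "hermite_phase n 0 = of_real (real m * pi + (pi / 2 + pi / 4))"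
      unfolding phase by (simp add: n field_simps)
    have half: "exp (\<i> * of_real (pi / 2)) = \<i>"
      by (simp add: complex_eq_iff Re_exp Im_exp)
    have quarter: "exp (\<i> * of_real (pi / 2 + pi / 4)) = \<i> * ?e"
        "exp (- (\<i> * of_real (pi / 2 + pi / 4))) = - \<i> * ?e'"
      by (simp_all only: of_real_add distrib_left exp_add exp_minus inverse_mult_distrib half) simp_all
    have rearrange: "t * (- \<i> * e) * ((0 + t * (2 * \<i> * a)) / 2) = t * (t * (a * e)) * (- \<i> * \<i>)"
        "t * (\<i> * e) * ((0 - t * (2 * \<i> * a)) / 2) = t * (t * (a * e)) * (- \<i> * \<i>)" for t e a :: complex
      by (simp_all add: algebra_simps)
    have "forward_amplitude n 0 = (- 1) ^ m * ((- 1) ^ m * (of_real (central_amplitude n) * ?e')) * (- \<i> * \<i>)"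
      unfolding forward_amplitude_def forward_wave_def wave0 cowave0 ph powers quarter by (rule rearrange)
    moreover have "backward_amplitude n 0 = (- 1) ^ m * ((- 1) ^ m * (of_real (central_amplitude n) * ?e)) * (- \<i> * \<i>)"
      unfolding backward_amplitude_def backward_wave_def wave0 cowave0 ph powers quarter by (rule rearrange)
    ultimately show "?F \<and> ?B" by (simp only: sq) simp
  qed
qed

section \<open>The asymptotic formula\<close>

text \<open>
  The right side is \<open>cosh (2 Im z)\<close>, so cosine and sine cannot be small at the same point.
\<close>

lemma trig_norm_sum:
  "norm (cos z) ^ 2 + norm (sin z) ^ 2 = (exp (2 * Im z) + exp (- (2 * Im z))) / 2" for z :: complex
proof -
  have e: "exp (2 * Im z) = (exp (Im z))\<^sup>2" "inverse (exp (2 * Im z)) = (inverse (exp (Im z)))\<^sup>2"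
    by (simp_all add: exp_double power_inverse)
  have c: "cos (2 * Re z) = 2 * (cos (Re z))\<^sup>2 - 1" by (rule cos_double_cos)
  show ?thesis
    unfolding norm_cos_squared norm_sin_squared exp_minus e c
    by (simp add: power2_diff add_divide_distrib diff_divide_distrib algebra_simps power_inverse)
qed

text \<open>
  Among all ways of writing \<open>d = a cos z + b sin z\<close>, the one with \<open>(a, b)\<close> proportional to the
  conjugate of \<open>(cos z, sin z)\<close> has the least norm. It gains the factor
  \<open>exp(-\<bar>Im z\<bar>)\<close>, and it exists for every \<open>R\<close>, whether or not \<open>d\<close> is small.
\<close>

lemma trig_error_splitting:
  fixes R z :: complex
  defines "d \<equiv> R - (cos z + sin z)" and "N \<equiv> complex_of_real (norm (cos z) ^ 2 + norm (sin z) ^ 2)"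
  shows "(1 + d * cnj (cos z) / N) * cos z + (1 + d * cnj (sin z) / N) * sin z = R"
    and "norm (d * cnj (cos z) / N) \<le> 2 * norm d * exp (- \<bar>Im z\<bar>)"
    and "norm (d * cnj (sin z) / N) \<le> 2 * norm d * exp (- \<bar>Im z\<bar>)"
proof -
  define M where "M = norm (cos z) ^ 2 + norm (sin z) ^ 2"
  define E where "E = exp \<bar>Im z\<bar>"
  have E: "0 < E" by (simp add: E_def)
  have M_E: "E\<^sup>2 \<le> 2 * M" "M \<le> E\<^sup>2"
    unfolding M_def E_def trig_norm_sum exp_double[symmetric] by (auto simp: abs_if)
  have M: "0 < M" using M_E(1) E by (smt (verit) zero_less_power)
  have N: "N = of_real M" by (simp add: N_def M_def)
  have "cnj (cos z) * cos z + cnj (sin z) * sin z = N"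
    by (simp add: N_def mult.commute complex_norm_square flip: of_real_power)
  then have "d * cnj (cos z) / N * cos z + d * cnj (sin z) / N * sin z = d * N / N"
    by (metis (no_types, lifting) add_divide_distrib distrib_left mult.assoc times_divide_eq_left)
  also have "\<dots> = d" using M by (simp add: N)
  finally have "d * cnj (cos z) / N * cos z + d * cnj (sin z) / N * sin z = d" .
  moreover have "(1 + a) * p + (1 + b) * q = (p + q) + (a * p + b * q)" for a b p q :: complex
    by (simp add: algebra_simps)
  ultimately show "(1 + d * cnj (cos z) / N) * cos z + (1 + d * cnj (sin z) / N) * sin z = R"
    by (simp only:) (simp add: d_def)
  have bound: "norm (d * cnj t / N) \<le> 2 * norm d * exp (- \<bar>Im z\<bar>)" if t: "norm t ^ 2 \<le> M" for t
  proof -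
    have "norm t \<le> E"
      using E by (intro power2_le_imp_le[OF order_trans[OF t M_E(2)]]) simp
    then have "norm d * norm t / M \<le> norm d * E / (E\<^sup>2 / 2)"
      using M_E(1) E by (intro frac_le mult_left_mono mult_nonneg_nonneg) auto
    also have "\<dots> = 2 * norm d * exp (- \<bar>Im z\<bar>)"
      using E by (simp add: power2_eq_square exp_minus field_simps flip: E_def)
    finally show ?thesis using M by (simp add: N norm_divide norm_mult)
  qed
  show "norm (d * cnj (cos z) / N) \<le> 2 * norm d * exp (- \<bar>Im z\<bar>)"
    by (rule bound) (simp add: M_def)
  show "norm (d * cnj (sin z) / N) \<le> 2 * norm d * exp (- \<bar>Im z\<bar>)"
    by (rule bound) (simp add: M_def)
qed

text \<open>
  The exact trigonometric target has both amplitudes equal to \<open>\<surd>2/2\<close>, with the same shift by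
  \<open>\<pi>/4\<close> as the Hermite waves at the origin.
\<close>

lemma cos_plus_sin_exp:
  "cos z + sin z = of_real (sqrt 2 / 2) * exp (- (\<i> * of_real (pi / 4))) * exp (\<i> * z) +
    of_real (sqrt 2 / 2) * exp (\<i> * of_real (pi / 4)) * exp (- (\<i> * z))"
proof -
  have "of_real (sqrt 2 / 2) * exp (- (\<i> * of_real (pi / 4))) = (1 - \<i>) / 2"
    by (simp add: complex_eq_iff Re_exp Im_exp sin_45 cos_45)
  moreover have "of_real (sqrt 2 / 2) * exp (\<i> * of_real (pi / 4)) = (1 + \<i>) / 2"
    by (simp add: complex_eq_iff Re_exp Im_exp sin_45 cos_45)
  ultimately show ?thesis
    by (simp only: cos_exp_eq sin_exp_eq) (simp add: field_simps)
qed

lemma hermite_wave_estimate: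
  assumes s: "0 < s" "s \<le> 1 - (Re y)\<^sup>2" and im: "\<bar>Im y\<bar> < 1" and n: "1 \<le> n"
    and \<kappa>: "\<kappa> = (5 / s + 20 / s\<^sup>2) / (8 * real n * s)" "4 * \<kappa> \<le> 1"
    and amp: "\<bar>central_amplitude n\<bar> \<le> 1"
  shows "norm (hermite_wave n y - (cos (hermite_phase n y) + sin (hermite_phase n y)))
    \<le> (24 * \<kappa> + 2 * \<bar>central_amplitude n - sqrt 2 / 2\<bar>) * exp \<bar>Im (hermite_phase n y)\<bar>"
proof -
  let ?\<Phi> = "hermite_phase n y" and ?a = "central_amplitude n"
  let ?e = "exp (\<i> * of_real (pi / 4))" and ?e' = "exp (- (\<i> * of_real (pi / 4)))"
  let ?E = "exp \<bar>Im ?\<Phi>\<bar>"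
  have unit: "norm ?e = 1" "norm ?e' = 1" by simp_all
  have init: "norm (forward_amplitude n 0) \<le> 1" "norm (backward_amplitude n 0) \<le> 1"
    using amp by (simp_all only: central_amplitudes norm_mult unit norm_of_real mult_1_right)
  note est = wave_estimate[OF s im n \<kappa> init]
  have "norm (exp (\<i> * ?\<Phi>)) \<le> ?E" "norm (exp (- (\<i> * ?\<Phi>))) \<le> ?E" by simp_all
  then have tail: "norm (exp (\<i> * ?\<Phi>) * (of_real (?a - sqrt 2 / 2) * ?e')) \<le> ?E * (\<bar>?a - sqrt 2 / 2\<bar> * 1)"
      "norm (exp (- (\<i> * ?\<Phi>)) * (of_real (?a - sqrt 2 / 2) * ?e)) \<le> ?E * (\<bar>?a - sqrt 2 / 2\<bar> * 1)"
    unfolding norm_mult unit norm_of_real by (intro mult_right_mono; simp)+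
  have "hermite_wave n y - (cos ?\<Phi> + sin ?\<Phi>) =
      ((forward_wave n y - exp (\<i> * ?\<Phi>) * forward_amplitude n 0) +
       (backward_wave n y - exp (- (\<i> * ?\<Phi>)) * backward_amplitude n 0)) +
      (exp (\<i> * ?\<Phi>) * (of_real (?a - sqrt 2 / 2) * ?e') +
       exp (- (\<i> * ?\<Phi>)) * (of_real (?a - sqrt 2 / 2) * ?e))"
  proof -
    have "hermite_wave n y = forward_wave n y + backward_wave n y"
      by (simp add: forward_wave_def backward_wave_def field_simps)
    then show ?thesis
      unfolding cos_plus_sin_exp central_amplitudes of_real_diff by (simp add: algebra_simps)
  qed
  also have "norm \<dots> \<le> (12 * \<kappa> * ?E + 12 * \<kappa> * ?E) + (?E * (\<bar>?a - sqrt 2 / 2\<bar> * 1) + ?E * (\<bar>?a - sqrt 2 / 2\<bar> * 1))"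
    by (intro order_trans[OF norm_triangle_ineq] add_mono est tail)
  also have "\<dots> = (24 * \<kappa> + 2 * \<bar>?a - sqrt 2 / 2\<bar>) * ?E"
    by (simp add: algebra_simps)
  finally show ?thesis .
qed

lemma monic_hermite_eq_wave:
  assumes "y \<in> unit_strip" "1 \<le> n"
  shows "poly (monic_hermite n) (of_real (sqrt (2 * real n)) * y) =
    of_real (hermite_scale n) * (exp (of_nat n * y\<^sup>2) / (1 - y\<^sup>2) powr (1 / 4)) * hermite_wave n y"
proof -
  have "hermite_scale n \<noteq> 0" using assms(2) by (simp add: hermite_scale_def)
  moreover have "(1 - y\<^sup>2) powr (1 / 4) \<noteq> 0"
    using one_minus_square_not_nonpos[OF assms(1)] by auto
  ultimately show ?thesis
    by (simp add: hermite_wave_def hermite_weight_def exp_minus field_simps)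
qed

theorem theorem3p2:
  fixes \<delta> :: real
  assumes "0 < \<delta>" and "\<delta> < 1"
  shows "\<exists>U :: complex set. \<exists>\<epsilon>1 \<epsilon>2 :: nat \<Rightarrow> complex \<Rightarrow> complex.
    open U \<and> complex_of_real ` {-1 + \<delta>..1 - \<delta>} \<subseteq> U \<and> U \<subseteq> unit_strip \<and>
    uniform_limit U \<epsilon>1 (\<lambda>_. 0) sequentially \<and>
    uniform_limit U \<epsilon>2 (\<lambda>_. 0) sequentially \<and>
    (\<forall>y\<in>U. \<forall>n\<ge>1.
      poly (monic_hermite n) (complex_of_real (sqrt (2 * real n)) * y) =
        complex_of_real ((real n / (2 * exp 1)) powr (real n / 2)) *
        (exp (of_nat n * y\<^sup>2) / (1 - y\<^sup>2) powr (1 / 4)) *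
        ((1 + \<epsilon>1 n y) * cos (hermite_phase n y) + (1 + \<epsilon>2 n y) * sin (hermite_phase n y)))"
proof -
  \<comment> \<open>The bound on the imaginary part is arbitrary: the phase is monotone on vertical lines in the whole strip.\<close>
  define U where "U = {y :: complex. \<bar>Re y\<bar> < 1 - \<delta> / 2 \<and> \<bar>Im y\<bar> < 1}"
  define s where "s = 1 - (1 - \<delta> / 2)\<^sup>2"
  define \<kappa> where "\<kappa> n = (5 / s + 20 / s\<^sup>2) / (8 * real n * s)" for n
  \<comment> \<open>The bound of \<open>hermite_wave_estimate\<close>; \<open>\<tau>\<close> tends to zero and does not depend on the point.\<close>
  define \<tau> where "\<tau> n = 24 * \<kappa> n + 2 * \<bar>central_amplitude n - sqrt 2 / 2\<bar>" for n
  define err where "err n y = hermite_wave n y - (cos (hermite_phase n y) + sin (hermite_phase n y))" for n y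
  define N where "N n y = complex_of_real (norm (cos (hermite_phase n y)) ^ 2 + norm (sin (hermite_phase n y)) ^ 2)" for n y
  define \<epsilon>1 where "\<epsilon>1 n y = err n y * cnj (cos (hermite_phase n y)) / N n y" for n y
  define \<epsilon>2 where "\<epsilon>2 n y = err n y * cnj (sin (hermite_phase n y)) / N n y" for n y
  note split = trig_error_splitting[of "hermite_wave n y" "hermite_phase n y" for n y,
      folded err_def N_def, folded \<epsilon>1_def \<epsilon>2_def]
  have s: "0 < s"
    using assms by (simp add: s_def abs_square_less_1)
  then have lim_\<kappa>: "\<kappa> \<longlonglongrightarrow> 0"
    unfolding \<kappa>_def by real_asymp
  have opn: "open U"
    unfolding U_def by (intro open_Collect_conj open_Collect_less continuous_intros)
  have cover: "complex_of_real ` {-1 + \<delta>..1 - \<delta>} \<subseteq> U"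
    using assms by (auto simp: U_def)
  have strip: "U \<subseteq> unit_strip"
    using assms by (auto simp: U_def unit_strip_def)
  have bound: "eventually (\<lambda>n. \<forall>y\<in>U. norm (\<epsilon>1 n y) \<le> 2 * \<tau> n \<and> norm (\<epsilon>2 n y) \<le> 2 * \<tau> n) sequentially"
  proof -
    have "eventually (\<lambda>n. \<kappa> n < 1 / 4) sequentially"
      using lim_\<kappa> by (rule order_tendstoD) simp
    moreover have "(\<lambda>n. \<bar>central_amplitude n\<bar>) \<longlonglongrightarrow> \<bar>sqrt 2 / 2\<bar>"
      by (intro tendsto_intros central_amplitude_limit)
    then have "eventually (\<lambda>n. \<bar>central_amplitude n\<bar> < 1) sequentially"
      by (rule order_tendstoD) (simp add: sqrt2_less_2)
    ultimately show ?thesis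
      using eventually_ge_at_top[of 1]
    proof eventually_elim
      case (elim n)
      show ?case
      proof
        fix y assume y: "y \<in> U"
        let ?E = "exp \<bar>Im (hermite_phase n y)\<bar>"
        have "\<bar>Re y\<bar> \<le> \<bar>1 - \<delta> / 2\<bar>"
          using y abs_ge_self[of "1 - \<delta> / 2"] unfolding U_def by force
        then have "s \<le> 1 - (Re y)\<^sup>2" by (simp add: s_def abs_le_square_iff)
        then have "norm (err n y) \<le> \<tau> n * ?E"
          unfolding err_def \<tau>_def
          using s y elim by (intro hermite_wave_estimate[where s = s]) (simp_all add: \<kappa>_def U_def)
        then have "2 * norm (err n y) * exp (- \<bar>Im (hermite_phase n y)\<bar>) \<le>
            2 * (\<tau> n * ?E) * exp (- \<bar>Im (hermite_phase n y)\<bar>)"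
          by (intro mult_right_mono mult_left_mono) auto
        also have "\<dots> = 2 * \<tau> n" by (simp add: exp_minus)
        finally show "norm (\<epsilon>1 n y) \<le> 2 * \<tau> n \<and> norm (\<epsilon>2 n y) \<le> 2 * \<tau> n"
          using split(2,3)[of n y] by linarith
      qed
    qed
  qed
  have lim_\<tau>: "(\<lambda>n. 2 * \<tau> n) \<longlonglongrightarrow> 0"
  proof -
    have "(\<lambda>n. 2 * (24 * \<kappa> n + 2 * \<bar>central_amplitude n - sqrt 2 / 2\<bar>)) \<longlonglongrightarrow>
        2 * (24 * 0 + 2 * \<bar>sqrt 2 / 2 - sqrt 2 / 2\<bar>)"
      by (intro tendsto_intros lim_\<kappa> central_amplitude_limit)
    then show ?thesis by (simp add: \<tau>_def)
  qed
  have small: "eventually (\<lambda>n. \<forall>y\<in>U. norm (\<epsilon>1 n y) < e \<and> norm (\<epsilon>2 n y) < e) sequentially"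
    if "0 < e" for e
  proof -
    have "eventually (\<lambda>n. 2 * \<tau> n < e) sequentially"
      using lim_\<tau> that by (rule order_tendstoD)
    with bound show ?thesis
      by eventually_elim (auto intro: le_less_trans)
  qed
  have "uniform_limit U \<epsilon>1 (\<lambda>_. 0) sequentially" "uniform_limit U \<epsilon>2 (\<lambda>_. 0) sequentially"
    unfolding uniform_limit_iff by (auto elim: eventually_mono[OF small])
  moreover have "\<forall>y\<in>U. \<forall>n\<ge>1.
      poly (monic_hermite n) (complex_of_real (sqrt (2 * real n)) * y) =
        complex_of_real ((real n / (2 * exp 1)) powr (real n / 2)) *
        (exp (of_nat n * y\<^sup>2) / (1 - y\<^sup>2) powr (1 / 4)) *
        ((1 + \<epsilon>1 n y) * cos (hermite_phase n y) + (1 + \<epsilon>2 n y) * sin (hermite_phase n y))"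
  proof (intro ballI allI impI)
    fix y and n :: nat assume "y \<in> U" "1 \<le> n"
    then show "poly (monic_hermite n) (complex_of_real (sqrt (2 * real n)) * y) =
        complex_of_real ((real n / (2 * exp 1)) powr (real n / 2)) *
        (exp (of_nat n * y\<^sup>2) / (1 - y\<^sup>2) powr (1 / 4)) *
        ((1 + \<epsilon>1 n y) * cos (hermite_phase n y) + (1 + \<epsilon>2 n y) * sin (hermite_phase n y))"
      unfolding split(1) hermite_scale_def[symmetric] by (intro monic_hermite_eq_wave) (use strip in auto)
  qed
  ultimately show ?thesis
    using opn cover strip by blast
qed

end
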